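(* Let $\mathcal P_n^*$ be the class of all density pairs $(p,q)$ satisfying the teacher assumptions (A1), (A2), (A3) stated in the context. Let $\tilde{\mathcal F}_n$ be an arbitrary function space. Then $$\inf_{\tilde f_n\in\tilde{\mathcal F}_n}\ \sup_{(p,q)\in\mathcal P_n^*}\mathbb E\big[\mathcal E(\tilde f_n,f_n^* )\big]=\tilde\Omega_d\left(\frac1n\right)^{\frac23},$$ where $\tilde\Omega_d$ hides the $\log n$ terms, which depend on $d$. Here the infimum is over estimators $\tilde f_n$ built from the $n$ observations with values in $\tilde{\mathcal F}_n$, and $f_n^*=p-q$ is the teacher network, whose sign is the Bayes classifier.
   Context: ReLU networks: $\sigma(x)=\max\{x,0\}$ applied coordinatewise. A ReLU network with $L$ hidden layers and parameters $\Theta=\{(W^{(l)},b^{(l)})\}_{l=1}^{L+1}$ is $f(\mathbf x|\Theta)=W^{(L+1)}\sigma(W^{(L)}\sigma(\cdots\sigma(W^{(1)}\mathbf x+b^{(1)})\cdots)+b^{(L)})+b^{(L+1)}$, real-valued, $\mathbf x\in\mathbb R^d$. $|\Theta|$ is the number of hidden layers, $N_{\max}(\Theta)$ the maximal width, $\|\Theta\|_0$ the number of nonzero parameters, $\|\Theta\|_\infty$ the largest absolute value of a parameter. $\mathcal F^{\mathrm{DNN}}(L,N,S,B,F)$ is the set of all such $f(\cdot|\Theta)$ with $|\Theta|\le L$, $N_{\max}(\Theta)\le N$, $\|\Theta\|_0\le S$, $\|\Theta\|_\infty\le B$, $\sup_{\mathbf x\in\mathcal X}|f(\mathbf x|\Theta)|\le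 F$. Classification model: $\mathbf x\in\mathcal X\subset\mathbb R^d$, $y\in\{-1,1\}$ with both labels equally likely; $\mathbf x|y=1$ has density $p$ and $\mathbf x|y=-1$ has density $q$, where $p,q$ are bounded densities on $\mathcal X$ with respect to Lebesgue measure $\mathbb Q$ (they may depend on $n$). The data $(\mathbf x_i,y_i)$, $i=1,\dots,n$, are i.i.d. from this model. A function $f$ defines the classifier $\mathrm{sign}(f)$, with decision region $\{f\ge0\}$ for label $1$. The 0-1 risk is $R(C)=P(C(\mathbf x)\ne y)$, and $R(f)$ means $R(\mathrm{sign}(f))$. The Bayes classifier has decision region $\{\mathbf x\in\mathcal X:p(\mathbf x)-q(\mathbf x)\ge0\}$. Excess risk: $\mathcal E(f,f_n^* )=R(f)-R(f_n^* )$, i.e. the risk of $f$ minus the Bayes risk. Teacher assumptions: (A1) $p,q$ have compact supports. (A2) $p(\mathbf x)-q(\mathbf x)$ is representable by some teacher ReLU network $f_n^*\in\mathcal F_n^*=\mathcal F^{\mathrm{DNN}}(L_n^*,N_n^*,S_n^*,B_n^*,F_n^* )$ with $N_n^*=O(\log n)^{m_*}$ and $L_n^*=O(1)$, for some $m_*\ge1$. (A3) For any $n$, there exist $c_n$ and $T_n$ with $c_n,1/T_n=O(\log n)^{m_*d^2L_n^*}$ such that $\mathbb Q\{\mathbf x\in\mathcal X:|f_n^*(\mathbf x)|\le t\}\le c_nt$ for all $0\le t\le T_n$. $a_n=\Omega(b_n)$ means that $a_n\ge Cb_n$ for a constant $C>0$ and all sufficiently large $n$; $\tilde\Omega_d$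 is the same up to logarithmic factors in $n$ depending on $d$.
   Formalization: The domain is assumed bounded, Borel and of positive Lebesgue measure, and the depth, width, sparsity, weight bound, sup bound and c_n are assumed eventually at least constants depending on d and the domain; otherwise the teacher class can be empty and the bound false. *)

theory Defs
  imports "HOL-Probability.Probability" "HOL-Library.Landau_Symbols"
    "Jordan_Normal_Form.Matrix"
begin

(* The parameters (W1,b1), ..., (W(L+1),b(L+1)) of a network with L hidden layers,
   first layer first. *)
type_synonym relu_params = "(real mat \<times> real Matrix.vec) list"

(* Matching dimensions for input dimension k and a single output. *)
primrec relu_params_wf :: "relu_params \<Rightarrow> nat \<Rightarrow> bool" where
  "relu_params_wf [] k = False"
| "relu_params_wf (l # \<theta>) k = (case l of (W, b) \<Rightarrow>
     0 < dim_row W \<and> dim_col W = k \<and> dim_vec b = dim_row W \<and>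
     (if \<theta> = [] then dim_row W = 1 else relu_params_wf \<theta> (dim_row W)))"

primrec relu_eval :: "relu_params \<Rightarrow> real Matrix.vec \<Rightarrow> real Matrix.vec" where
  "relu_eval [] v = v"
| "relu_eval (l # \<theta>) v = (case l of (W, b) \<Rightarrow>
     if \<theta> = [] then W *\<^sub>v v + b
     else relu_eval \<theta> (map_vec (\<lambda>t. max t 0) (W *\<^sub>v v + b)))"

(* Weight matrices have numbered columns, so the coordinates of real^'d are enumerated.
   Permuting the columns of the first weight matrix changes none of the size measures below,
   so the function classes do not depend on the enumeration chosen. *)
definition coord :: "nat \<Rightarrow> 'd::finite" where
  "coord = (SOME e. bij_betw e {..<CARD('d)} UNIV)"

definition coord_vec :: "real ^ 'd \<Rightarrow> real Matrix.vec" where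
  "coord_vec x = Matrix.vec CARD('d) (\<lambda>i. vec_nth x (coord i))"

definition relu_net :: "relu_params \<Rightarrow> real ^ 'd \<Rightarrow> real" where
  "relu_net \<theta> x = vec_index (relu_eval \<theta> (coord_vec x)) 0"

definition hidden_layers :: "relu_params \<Rightarrow> nat" where
  "hidden_layers \<theta> = length \<theta> - 1"

(* The last layer is the output layer; only hidden layers have a width. *)
definition max_width :: "relu_params \<Rightarrow> nat" where
  "max_width \<theta> = Max (insert 0 ((\<lambda>(W, b). dim_row W) ` set (butlast \<theta>)))"

definition nonzero_params :: "relu_params \<Rightarrow> nat" where
  "nonzero_params \<theta> = (\<Sum>(W, b)\<leftarrow>\<theta>.
     card {(i, j). i < dim_row W \<and> j < dim_col W \<and> index_mat W (i, j) \<noteq> 0}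
     + card {i. i < dim_vec b \<and> vec_index b i \<noteq> 0})"

definition max_param :: "relu_params \<Rightarrow> real" where
  "max_param \<theta> = Max (insert 0 (\<Union>(W, b)\<in>set \<theta>. abs ` (elements_mat W \<union> vec_set b)))"

definition DNN ::
  "(real ^ 'd) set \<Rightarrow> nat \<Rightarrow> nat \<Rightarrow> nat \<Rightarrow> real \<Rightarrow> real \<Rightarrow> (real ^ 'd \<Rightarrow> real) set" where
  "DNN X L N S B F = {relu_net \<theta> | \<theta>.
     relu_params_wf \<theta> CARD('d) \<and> hidden_layers \<theta> \<le> L \<and> max_width \<theta> \<le> N \<and>
     nonzero_params \<theta> \<le> S \<and> max_param \<theta> \<le> B \<and> (\<forall>x\<in>X. \<bar>relu_net \<theta> x\<bar> \<le> F)}"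

(* Densities, networks and classifiers are total functions of which only the values on the
   domain X matter. *)
definition bounded_density :: "(real ^ 'd) set \<Rightarrow> (real ^ 'd \<Rightarrow> real) \<Rightarrow> bool" where
  "bounded_density X p \<longleftrightarrow>
     p \<in> borel_measurable (restrict_space borel X) \<and> (\<forall>x\<in>X. 0 \<le> p x) \<and>
     (\<exists>M. \<forall>x\<in>X. p x \<le> M) \<and> (\<integral>\<^sup>+x. ennreal (p x) \<partial>restrict_space lborel X) = 1"

definition obs_space :: "(real ^ 'd) set \<Rightarrow> ((real ^ 'd) \<times> int) measure" where
  "obs_space X = restrict_space lborel X \<Otimes>\<^sub>M count_space {-1, 1}"

(* The joint law of (x, y): both labels have probability 1/2, and x has density p given y = 1
   and density q given y = -1. *)
definition obs_distr ::
  "(real ^ 'd) set \<Rightarrow> (real ^ 'd \<Rightarrow> real) \<Rightarrow> (real ^ 'd \<Rightarrow> real) \<Rightarrow> ((real ^ 'd) \<times> int) measure" where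
  "obs_distr X p q =
     density (obs_space X) (\<lambda>(x, y). ennreal (1 / 2 * (if y = 1 then p x else q x)))"

definition sample_distr ::
  "(real ^ 'd) set \<Rightarrow> (real ^ 'd \<Rightarrow> real) \<Rightarrow> (real ^ 'd \<Rightarrow> real) \<Rightarrow> nat
     \<Rightarrow> (nat \<Rightarrow> (real ^ 'd) \<times> int) measure" where
  "sample_distr X p q n = Pi\<^sub>M {..<n} (\<lambda>_. obs_distr X p q)"

definition sign_classifier :: "(real ^ 'd \<Rightarrow> real) \<Rightarrow> real ^ 'd \<Rightarrow> int" where
  "sign_classifier f x = (if 0 \<le> f x then 1 else -1)"

definition risk ::
  "(real ^ 'd) set \<Rightarrow> (real ^ 'd \<Rightarrow> real) \<Rightarrow> (real ^ 'd \<Rightarrow> real) \<Rightarrow> (real ^ 'd \<Rightarrow> int) \<Rightarrow> real" where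
  "risk X p q C =
     measure (obs_distr X p q) {(x, y) \<in> space (obs_distr X p q). C x \<noteq> y}"

definition excess_risk ::
  "(real ^ 'd) set \<Rightarrow> (real ^ 'd \<Rightarrow> real) \<Rightarrow> (real ^ 'd \<Rightarrow> real)
     \<Rightarrow> (real ^ 'd \<Rightarrow> real) \<Rightarrow> (real ^ 'd \<Rightarrow> real) \<Rightarrow> real" where
  "excess_risk X p q f g =
     risk X p q (sign_classifier f) - risk X p q (sign_classifier g)"

(* The class at one fixed sample size. All bounds are parameters, so that the asymptotic
   conditions on them are imposed on sequences of parameters. Equality of p - q with the
   teacher network is required everywhere on X. *)
definition teacher_class ::
  "(real ^ 'd) set \<Rightarrow> nat \<Rightarrow> nat \<Rightarrow> nat \<Rightarrow> real \<Rightarrow> real \<Rightarrow> real \<Rightarrow> real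
     \<Rightarrow> ((real ^ 'd \<Rightarrow> real) \<times> (real ^ 'd \<Rightarrow> real)) set" where
  "teacher_class X L N S B F c T = {(p, q).
     bounded_density X p \<and> bounded_density X q \<and>
     compact (closure {x\<in>X. p x \<noteq> 0}) \<and> compact (closure {x\<in>X. q x \<noteq> 0}) \<and>
     (\<exists>f\<in>DNN X L N S B F. (\<forall>x\<in>X. p x - q x = f x) \<and>
        (\<forall>t. 0 \<le> t \<and> t \<le> T \<longrightarrow> emeasure lborel {x\<in>X. \<bar>f x\<bar> \<le> t} \<le> ennreal (c * t)))}"

(* Joint measurability in the sample and in x makes the excess risk of the estimate a random
   variable. *)
definition estimators ::
  "(real ^ 'd) set \<Rightarrow> nat \<Rightarrow> (real ^ 'd \<Rightarrow> real) set
     \<Rightarrow> ((nat \<Rightarrow> (real ^ 'd) \<times> int) \<Rightarrow> real ^ 'd \<Rightarrow> real) set" where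
  "estimators X n G = {h.
     (\<forall>D\<in>space (Pi\<^sub>M {..<n} (\<lambda>_. obs_space X)). h D \<in> G) \<and>
     (\<lambda>(D, x). h D x) \<in> borel_measurable
        (Pi\<^sub>M {..<n} (\<lambda>_. obs_space X) \<Otimes>\<^sub>M restrict_space borel X)}"

(* On X the teacher network is p - q. The value is an extended real because the infimum over
   an empty set of estimators is infinite. *)
definition minimax_excess_risk ::
  "(real ^ 'd) set \<Rightarrow> nat \<Rightarrow> (real ^ 'd \<Rightarrow> real) set
     \<Rightarrow> ((real ^ 'd \<Rightarrow> real) \<times> (real ^ 'd \<Rightarrow> real)) set \<Rightarrow> ereal" where
  "minimax_excess_risk X n G P =
     (INF h\<in>estimators X n G. SUP (p, q)\<in>P.
        ereal (\<integral>D. excess_risk X p q (h D) (\<lambda>x. p x - q x) \<partial>sample_distr X p q n))"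

definition tilde_Omega :: "real \<Rightarrow> (nat \<Rightarrow> ereal) \<Rightarrow> (nat \<Rightarrow> real) \<Rightarrow> bool" where
  "tilde_Omega k a b \<longleftrightarrow>
     (\<exists>C>0. \<forall>\<^sub>F n in sequentially. ereal (C * b n / ln (real n) powr k) \<le> a n)"

end

(* Le Cam's two-point method. Both hypotheses depend on a single coordinate t, and p + q is the
   same constant for both. The contrasts f = p - q are increasing piecewise linear functions of t
   with slopes bounded away from zero (hence the margin condition), which up to a correction of
   order \<delta>^2 differ only on an interval of length 2\<delta>, by at most \<delta>; there they cross zero at
   different points. The chi-square distance of the two laws is then of order \<delta>^3, so that
   n observations cannot separate them for \<delta> = \<rho> n^(-1/3), while a classifier errs by a constant
   fraction of \<delta>^2 in total. As X is arbitrary, the crossing is placed by pigeonhole where X has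
   mass of order \<delta>, and the slope on the left is chosen so that f integrates to zero on X. *)
theory Submission
  imports Defs
begin

text \<open>The exponent comes from two local counts. The contrasts differ by at most \<delta> on a
  slab of mass O(\<delta>), so their squared distance is O(\<delta>^3). On a thinner slab with mass
  of order \<delta> they have opposite signs and size of order \<delta>, so the decisions there cost
  \<delta>^2. Keeping n * \<delta>^3 below a constant turns \<delta>^2 into n^(-2/3). With p + q
  constant and f at most 1/V, V the volume of X, both densities lie between 1/(2V) and 3/(2V); the
  chi-square distance is then controlled by the squared distance of the contrasts. The obstacle is
  that X is only a bounded Borel set of positive measure: slabs have at most linear mass, but no
  given slab has to be charged at all, and no symmetry makes a contrast integrate to zero. Hence the
  common centre moves with \<delta>, and each hypothesis has its own left slope. The slopes differ
  by O(\<delta>^2); this is felt on all of X, but adds only O(\<delta>^4) to the squared distance.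
  Keeping the centre between the tertiles of t bounds the slopes from both sides, so that the
  network and margin constants do not depend on n.\<close>

section \<open>Testing two product measures\<close>

text \<open>The likelihood ratio of an i.i.d. sample is the product of the single ratios. Measures
  on a finite product that agree on boxes are equal, and on a box both sides factor.\<close>

lemma PiM_density:
  fixes M :: "'a measure" and l :: "'a \<Rightarrow> ennreal" and I :: "'i set"
  assumes "finite I" "sigma_finite_measure M" "sigma_finite_measure (density M l)"
    and [measurable]: "l \<in> borel_measurable M"
  shows "PiM I (\<lambda>_. density M l) = density (PiM I (\<lambda>_. M)) (\<lambda>x. \<Prod>i\<in>I. l (x i))"
proof (rule sym, rule product_sigma_finite.PiM_eqI)
  interpret P: product_sigma_finite "\<lambda>_ :: 'i. M"
    using assms by (simp add: product_sigma_finite_def)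
  show "product_sigma_finite (\<lambda>_ :: 'i. density M l)"
    using assms by (simp add: product_sigma_finite_def)
  show "finite I" by fact
  show "sets (density (Pi\<^sub>M I (\<lambda>_. M)) (\<lambda>x. \<Prod>i\<in>I. l (x i))) = sets (Pi\<^sub>M I (\<lambda>_. density M l))"
    by (auto intro!: sets_PiM_cong)
  fix A assume A: "\<And>i. i \<in> I \<Longrightarrow> A i \<in> sets (density M l)"
  then have A': "\<And>i. i \<in> I \<Longrightarrow> A i \<in> sets M" by simp
  have "emeasure (density (Pi\<^sub>M I (\<lambda>_. M)) (\<lambda>x. \<Prod>i\<in>I. l (x i))) (Pi\<^sub>E I A)
      = (\<integral>\<^sup>+x. (\<Prod>i\<in>I. l (x i)) * indicator (Pi\<^sub>E I A) x \<partial>Pi\<^sub>M I (\<lambda>_. M))"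
    using A' assms(1) by (intro emeasure_density) (auto intro!: sets_PiM_I_finite)
  also have "\<dots> = (\<integral>\<^sup>+x. (\<Prod>i\<in>I. l (x i) * indicator (A i) (x i)) \<partial>Pi\<^sub>M I (\<lambda>_. M))"
    using assms(1) by (intro nn_integral_cong) (auto simp: indicator_def prod.distrib space_PiM PiE_def Pi_def)
  also have "\<dots> = (\<Prod>i\<in>I. \<integral>\<^sup>+x. l x * indicator (A i) x \<partial>M)"
    using A' assms(1) by (intro P.product_nn_integral_prod) auto
  also have "\<dots> = (\<Prod>i\<in>I. emeasure (density M l) (A i))"
    using A' by (intro prod.cong) (auto simp: emeasure_density)
  finally show "emeasure (density (Pi\<^sub>M I (\<lambda>_. M)) (\<lambda>x. \<Prod>i\<in>I. l (x i))) (Pi\<^sub>E I A)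
      = (\<Prod>i\<in>I. emeasure (density M l) (A i))" .
qed

text \<open>The second-moment method: \<open>\<bar>L - 1\<bar> \<le> 1/4 + (L - 1)\<^sup>2\<close> for the likelihood ratio \<open>L\<close> of the
  samples avoids both the Cauchy--Schwarz inequality and the total variation distance.\<close>
lemma two_point_test:
  fixes M :: "'a measure" and l :: "'a \<Rightarrow> real" and n :: nat and Z :: "(nat \<Rightarrow> 'a) \<Rightarrow> real"
  assumes "prob_space M" and l_pos: "\<And>x. 0 \<le> l x"
    and l: "integrable M l" "(\<integral>x. l x \<partial>M) = 1"
    and l2: "integrable M (\<lambda>x. (l x)\<^sup>2)" "(\<integral>x. (l x)\<^sup>2 \<partial>M) \<le> 1 + \<kappa>"
    and \<kappa>: "real n * \<kappa> \<le> 1 / 5"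
    and Z[measurable]: "Z \<in> borel_measurable (PiM {..<n} (\<lambda>_. M))"
    and Z01: "\<And>x. x \<in> space (PiM {..<n} (\<lambda>_. M)) \<Longrightarrow> 0 \<le> Z x \<and> Z x \<le> 1"
  shows "1 / 2 \<le> (\<integral>x. Z x \<partial>PiM {..<n} (\<lambda>_. density M l)) + (\<integral>x. 1 - Z x \<partial>PiM {..<n} (\<lambda>_. M))"
proof -
  interpret M: prob_space M by fact
  have lm[measurable]: "l \<in> borel_measurable M" using l(1) by auto
  have nn: "(\<integral>\<^sup>+x. ennreal (l x) \<partial>M) = 1"
    using l l_pos by (subst nn_integral_eq_integral) auto
  interpret M': prob_space "density M l"
    by (rule prob_spaceI) (simp add: emeasure_density nn cong: nn_integral_cong)
  interpret P: product_sigma_finite "\<lambda>_ :: nat. M"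
    by (simp add: product_sigma_finite_def M.sigma_finite_measure_axioms)
  let ?N = "PiM {..<n} (\<lambda>_. M)"
  interpret N: prob_space ?N by (intro prob_space_PiM) (rule assms)
  define L where "L = (\<lambda>x. \<Prod>i<n. l (x i))"
  have L_pos: "0 \<le> L x" for x by (simp add: L_def prod_nonneg l_pos)
  have Lm[measurable]: "L \<in> borel_measurable ?N" unfolding L_def by measurable
  have L1: "integrable ?N L" "(\<integral>x. L x \<partial>?N) = 1"
    using P.product_integrable_prod[of "{..<n}" "\<lambda>_. l"] P.product_integral_prod[of "{..<n}" "\<lambda>_. l"] l
    by (auto simp: L_def)
  have L_sq: "(L x)\<^sup>2 = (\<Prod>i<n. (l (x i))\<^sup>2)" for x
    by (simp add: L_def prod_power_distrib)
  have L2: "integrable ?N (\<lambda>x. (L x)\<^sup>2)" "(\<integral>x. (L x)\<^sup>2 \<partial>?N) = (\<integral>x. (l x)\<^sup>2 \<partial>M) ^ n"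
    using P.product_integrable_prod[of "{..<n}" "\<lambda>_ x. (l x)\<^sup>2"]
      P.product_integral_prod[of "{..<n}" "\<lambda>_ x. (l x)\<^sup>2"] l2
    by (auto simp: L_sq)
  \<comment> \<open>No sign is assumed for \<kappa>; this supplies the nonnegative base that
    \<open>power_mono\<close> asks for below.\<close>
  have "0 \<le> (\<integral>x. (l x)\<^sup>2 \<partial>M)" by (rule Bochner_Integration.integral_nonneg) simp
  then have chi0: "0 \<le> 1 + \<kappa>" using l2(2) by (rule order_trans)
  have "(\<integral>x. (L x)\<^sup>2 \<partial>?N) \<le> (1 + \<kappa>) ^ n"
    unfolding L2 using l2(2) by (intro power_mono) auto
  also have "\<dots> \<le> exp \<kappa> ^ n" using chi0 by (intro power_mono exp_ge_add_one_self) auto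
  also have "\<dots> = exp (real n * \<kappa>)" by (simp add: exp_of_nat_mult)
  also have "\<dots> \<le> exp (1/5)" using \<kappa> by simp
  \<comment> \<open>Source of the threshold 1/5: exp(1/5) is at most 1 + 1/5 + 1/25, so the variance
    of \<open>L\<close> is at most 1/4.\<close>
  also have "\<dots> \<le> 5/4" using exp_bound[of "1/5::real"] by (simp add: power2_eq_square)
  finally have L2b: "(\<integral>x. (L x)\<^sup>2 \<partial>?N) \<le> 5/4" .
  have Zi: "integrable ?N Z"
    by (rule N.integrable_const_bound[where B = 1]) (use Z01 in auto)
  have LZi: "integrable ?N (\<lambda>x. L x * Z x)"
    by (rule Bochner_Integration.integrable_bound[OF L1(1)])
      (use Z01 L_pos in \<open>auto simp: abs_mult intro!: AE_I2 mult_left_le\<close>)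
  have "PiM {..<n} (\<lambda>_. density M l) = density ?N (\<lambda>x. \<Prod>i<n. ennreal (l (x i)))"
    by (rule PiM_density)
      (auto simp: M.sigma_finite_measure_axioms M'.sigma_finite_measure_axioms)
  also have "\<dots> = density ?N L"
    by (simp add: L_def prod_ennreal l_pos)
  finally have "(\<integral>x. Z x \<partial>PiM {..<n} (\<lambda>_. density M l)) = (\<integral>x. L x * Z x \<partial>?N)"
    by (simp add: integral_density L_pos)
  \<comment> \<open>The sum of both errors is the mean of 1 + (L - 1) Z, which is at least 1 -
    \<bar>L - 1\<bar>, hence at least 3/4 - (L - 1)^2. The variance bound leaves 3/4 - 1/4.\<close>
  moreover have "(\<integral>x. 3/4 - ((L x)\<^sup>2 - 2 * L x + 1) \<partial>?N) \<le> (\<integral>x. L x * Z x + (1 - Z x) \<partial>?N)"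
  proof (rule integral_mono)
    fix x assume "x \<in> space ?N"
    then have Z: "0 \<le> Z x" "Z x \<le> 1" using Z01 by auto
    have "- (L x - 1) * Z x \<le> \<bar>L x - 1\<bar> * 1"
      using Z by (intro mult_mono) auto
    moreover have "\<bar>L x - 1\<bar> \<le> 1/4 + (L x - 1)\<^sup>2"
      using zero_le_power2[of "\<bar>L x - 1\<bar> - 1/2"] by (simp add: power2_diff power_divide)
    ultimately show "3/4 - ((L x)\<^sup>2 - 2 * L x + 1) \<le> L x * Z x + (1 - Z x)"
      by (simp add: algebra_simps power2_eq_square)
  qed (use L1 L2 LZi Zi in auto)
  moreover have "(\<integral>x. 3/4 - ((L x)\<^sup>2 - 2 * L x + 1) \<partial>?N) = 3/4 - ((\<integral>x. (L x)\<^sup>2 \<partial>?N) - 2 + 1)"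
    using L1 L2(1) by (simp add: N.prob_space)
  moreover have "(\<integral>x. L x * Z x + (1 - Z x) \<partial>?N) = (\<integral>x. L x * Z x \<partial>?N) + (\<integral>x. 1 - Z x \<partial>?N)"
    using LZi Zi by simp
  ultimately show ?thesis using L2b by linarith
qed

section \<open>Risks in the observation model\<close>

abbreviation leb_on :: "(real ^ 'd::finite) set \<Rightarrow> (real ^ 'd) measure" where
  "leb_on X \<equiv> restrict_space lborel X"

lemma space_leb_on: "space (leb_on X) = X"
  by (simp add: space_restrict_space)

lemma finite_measure_leb_on:
  assumes "X \<in> sets borel" "bounded X"
  shows "finite_measure (leb_on X)"
  using emeasure_bounded_finite[OF assms(2)] assms(1)
  by (intro finite_measureI) (auto simp: emeasure_restrict_space space_restrict_space)

lemma finite_measure_obs_space: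
  assumes "X \<in> sets borel" "bounded X"
  shows "finite_measure (obs_space X)"
  unfolding obs_space_def
  by (intro finite_measure_pair_measure finite_measure_leb_on assms finite_measure_count_space) auto

lemma integral_obs_space:
  fixes g :: "(real ^ 'd::finite) \<times> int \<Rightarrow> real"
  assumes "X \<in> sets borel" "bounded X" "integrable (obs_space X) g"
  shows "(\<integral>z. g z \<partial>obs_space X) = (\<integral>x. g (x, 1) + g (x, -1) \<partial>leb_on X)"
proof -
  interpret M: finite_measure "leb_on X" by (intro finite_measure_leb_on assms)
  interpret C: finite_measure "count_space {-1, 1::int}" by (intro finite_measure_count_space) auto
  interpret P: pair_sigma_finite "leb_on X" "count_space {-1, 1::int}" ..
  have "(\<integral>z. g z \<partial>obs_space X) = (\<integral>x. \<integral>y. g (x, y) \<partial>count_space {-1, 1} \<partial>leb_on X)"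
    using P.integral_fst'[of g] assms(3) by (simp add: obs_space_def)
  also have "\<dots> = (\<integral>x. g (x, 1) + g (x, -1) \<partial>leb_on X)"
    by (intro Bochner_Integration.integral_cong) (auto simp: lebesgue_integral_count_space_finite)
  finally show ?thesis .
qed

text \<open>Densities and estimators are declared measurable over \<open>borel\<close>, whereas
  integration is over \<open>lborel\<close>; this identification allows passing from one to the
  other.\<close>

lemma sets_restrict_leb:
  assumes "X \<in> sets borel"
  shows "sets (restrict_space borel X) = sets (leb_on X)"
  by (intro sets_restrict_space_cong) simp

lemma measurable_leb_on:
  assumes "X \<in> sets borel"
  shows "measurable (restrict_space borel X) N = measurable (leb_on X) N"
  by (intro measurable_cong_sets sets_restrict_leb assms refl)

lemma obs_space_label_measurable:
  fixes p q :: "real ^ 'd::finite \<Rightarrow> real"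
  assumes [measurable]: "p \<in> borel_measurable (leb_on X)" "q \<in> borel_measurable (leb_on X)"
  shows "(\<lambda>(x, y). 1 / 2 * (if y = 1 then p x else q x)) \<in> borel_measurable (obs_space X)"
  unfolding obs_space_def by measurable

lemma bounded_densityD:
  assumes "X \<in> sets borel" "bounded_density X p"
  shows "p \<in> borel_measurable (leb_on X)" and "x \<in> X \<Longrightarrow> 0 \<le> p x"
    and "\<exists>M. \<forall>x\<in>X. \<bar>p x\<bar> \<le> M"
  using assms measurable_leb_on[OF assms(1), of "borel::real measure"]
  by (auto simp: bounded_density_def)

text \<open>A bounded \<open>g\<close> is integrable because \<open>X\<close> has finite volume and
  the densities are bounded. The later applications are to constants, indicators, the likelihood
  ratio and its square.\<close>

lemma integral_obs_distr:
  fixes g :: "(real ^ 'd::finite) \<times> int \<Rightarrow> real"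
  assumes X: "X \<in> sets borel" "bounded X" and pq: "bounded_density X p" "bounded_density X q"
    and g[measurable]: "g \<in> borel_measurable (obs_space X)"
    and B: "\<And>z. z \<in> space (obs_space X) \<Longrightarrow> \<bar>g z\<bar> \<le> B"
  shows "integrable (obs_distr X p q) g"
    and "(\<integral>z. g z \<partial>obs_distr X p q) = (\<integral>x. 1 / 2 * (p x * g (x, 1) + q x * g (x, -1)) \<partial>leb_on X)"
proof -
  define r where "r = (\<lambda>(x::real^'d, y::int). 1 / 2 * (if y = 1 then p x else q x))"
  note [measurable] = bounded_densityD(1)[OF X(1) pq(1)] bounded_densityD(1)[OF X(1) pq(2)]
  have r[measurable]: "r \<in> borel_measurable (obs_space X)"
    unfolding r_def by (rule obs_space_label_measurable) measurable
  have spc: "space (obs_space X) = X \<times> {-1, 1}"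
    by (simp add: obs_space_def space_pair_measure space_leb_on)
  have r0: "AE z in obs_space X. 0 \<le> r z"
    using bounded_densityD(2)[OF X(1) pq(1)] bounded_densityD(2)[OF X(1) pq(2)]
    by (intro AE_I2) (auto simp: spc r_def)
  have distr: "obs_distr X p q = density (obs_space X) r"
    by (simp add: obs_distr_def r_def case_prod_unfold)
  obtain Mp Mq where M: "\<forall>x\<in>X. \<bar>p x\<bar> \<le> Mp" "\<forall>x\<in>X. \<bar>q x\<bar> \<le> Mq"
    using bounded_densityD(3)[OF X(1) pq(1)] bounded_densityD(3)[OF X(1) pq(2)] by auto
  have rb: "\<bar>r z\<bar> \<le> \<bar>Mp\<bar> + \<bar>Mq\<bar>" if "z \<in> space (obs_space X)" for z
    using that M by (fastforce simp: spc r_def)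
  have int: "integrable (obs_space X) (\<lambda>z. r z * g z)"
  proof (rule finite_measure.integrable_const_bound[OF finite_measure_obs_space[OF X]])
    show "AE z in obs_space X. norm (r z * g z) \<le> (\<bar>Mp\<bar> + \<bar>Mq\<bar>) * \<bar>B\<bar>"
      using rb B by (intro AE_I2) (auto simp: abs_mult intro!: mult_mono order_trans[OF B])
  qed measurable
  show "integrable (obs_distr X p q) g"
    unfolding distr using int r0 by (simp add: integrable_density)
  have "(\<integral>z. g z \<partial>obs_distr X p q) = (\<integral>z. r z * g z \<partial>obs_space X)"
    unfolding distr using r0 by (simp add: integral_density)
  also have "\<dots> = (\<integral>x. r (x, 1) * g (x, 1) + r (x, -1) * g (x, -1) \<partial>leb_on X)"
    by (rule integral_obs_space[OF X int])
  also have "\<dots> = (\<integral>x. 1 / 2 * (p x * g (x, 1) + q x * g (x, -1)) \<partial>leb_on X)"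
    by (simp add: r_def algebra_simps)
  finally show "(\<integral>z. g z \<partial>obs_distr X p q) = (\<integral>x. 1 / 2 * (p x * g (x, 1) + q x * g (x, -1)) \<partial>leb_on X)" .
qed

lemma bounded_density_integral:
  assumes X: "X \<in> sets borel" "bounded X" and p: "bounded_density X p"
  shows "integrable (leb_on X) p" "(\<integral>x. p x \<partial>leb_on X) = 1"
proof -
  obtain M where M: "\<forall>x\<in>X. \<bar>p x\<bar> \<le> M" using bounded_densityD(3)[OF X(1) p] by auto
  show int: "integrable (leb_on X) p"
    by (rule finite_measure.integrable_const_bound[OF finite_measure_leb_on[OF X], where B = M])
      (use M bounded_densityD(1)[OF X(1) p] in \<open>auto simp: space_leb_on\<close>)
  have "ennreal (\<integral>x. p x \<partial>leb_on X) = (\<integral>\<^sup>+x. ennreal (p x) \<partial>leb_on X)"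
    using bounded_densityD(2)[OF X(1) p]
    by (subst nn_integral_eq_integral[OF int]) (auto simp: space_leb_on)
  also have "\<dots> = 1" using p by (simp add: bounded_density_def)
  finally show "(\<integral>x. p x \<partial>leb_on X) = 1" by simp
qed

lemma sets_obs_distr [measurable_cong]: "sets (obs_distr X p q) = sets (obs_space X)"
  by (simp add: obs_distr_def)

lemma prob_space_obs_distr:
  assumes X: "X \<in> sets borel" "bounded X" and pq: "bounded_density X p" "bounded_density X q"
  shows "prob_space (obs_distr X p q)"
proof -
  have e: "(\<integral>z. 1 \<partial>obs_distr X p q) = (\<integral>x. 1 / 2 * (p x * 1 + q x * 1) \<partial>leb_on X)"
    by (rule integral_obs_distr(2)[OF X pq, of _ 1]) simp_all
  note e
  also have "(\<integral>x. 1 / 2 * (p x * 1 + q x * 1) \<partial>leb_on X) = 1 / 2 * ((\<integral>x. p x \<partial>leb_on X) + (\<integral>x. q x \<partial>leb_on X))"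
    using bounded_density_integral(1)[OF X pq(1)] bounded_density_integral(1)[OF X pq(2)] by simp
  finally have e: "(\<integral>z. 1 \<partial>obs_distr X p q) = (1::real)"
    using bounded_density_integral(2)[OF X pq(1)] bounded_density_integral(2)[OF X pq(2)] by simp
  \<comment> \<open>A real total mass of 1 also excludes infinite mass, since
    \<open>enn2real\<close> sends infinity to 0.\<close>
  then show ?thesis
    by (intro prob_spaceI) (simp add: measure_def)
qed

text \<open>Deciding for label 1 errs exactly on label -1, whose density is \<open>q\<close>, and
  conversely.\<close>

lemma risk_eq:
  assumes X: "X \<in> sets borel" "bounded X" and pq: "bounded_density X p" "bounded_density X q"
    and f[measurable]: "f \<in> borel_measurable (leb_on X)"
  shows "risk X p q (sign_classifier f) = (\<integral>x. 1 / 2 * (if 0 \<le> f x then q x else p x) \<partial>leb_on X)"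
proof -
  define A where "A = {z \<in> space (obs_space X). sign_classifier f (fst z) \<noteq> snd z}"
  have [measurable]: "A \<in> sets (obs_space X)"
    unfolding A_def obs_space_def sign_classifier_def by measurable
  have "risk X p q (sign_classifier f) = measure (obs_distr X p q) A"
    by (simp add: risk_def A_def case_prod_unfold obs_distr_def)
  also have "\<dots> = (\<integral>z. indicator A z \<partial>obs_distr X p q)"
    by (simp add: sets_obs_distr A_def obs_distr_def Int_absorb2 sets.sets_into_space)
  also have "\<dots> = (\<integral>x. 1 / 2 * (p x * indicator A (x, 1) + q x * indicator A (x, -1)) \<partial>leb_on X)"
    by (intro integral_obs_distr(2)[OF X pq, of _ 1]) (auto simp: indicator_def)
  also have "\<dots> = (\<integral>x. 1 / 2 * (if 0 \<le> f x then q x else p x) \<partial>leb_on X)"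
    by (intro Bochner_Integration.integral_cong)
      (auto simp: A_def obs_space_def space_pair_measure space_leb_on sign_classifier_def)
  finally show ?thesis .
qed

text \<open>The pointwise risks differ only where the decision deviates from the Bayes decision, and
  there by half of \<bar>p - q\<bar>. This reduces the excess risk to the sign and size of the
  contrast.\<close>

lemma excess_risk_eq:
  assumes X: "X \<in> sets borel" "bounded X" and pq: "bounded_density X p" "bounded_density X q"
    and f[measurable]: "f \<in> borel_measurable (leb_on X)"
  shows "excess_risk X p q f (\<lambda>x. p x - q x)
    = (\<integral>x. 1 / 2 * (if (0 \<le> f x) = (0 \<le> p x - q x) then 0 else \<bar>p x - q x\<bar>) \<partial>leb_on X)"
proof -
  note [measurable] = bounded_densityD(1)[OF X(1) pq(1)] bounded_densityD(1)[OF X(1) pq(2)]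
  note ints = bounded_density_integral(1)[OF X pq(1)] bounded_density_integral(1)[OF X pq(2)]
  have int: "integrable (leb_on X) (\<lambda>x. 1 / 2 * (if 0 \<le> g x then q x else p x))"
    if [measurable]: "g \<in> borel_measurable (leb_on X)" for g :: "_ \<Rightarrow> real"
  proof (rule Bochner_Integration.integrable_bound)
    show "integrable (leb_on X) (\<lambda>x. \<bar>p x\<bar> + \<bar>q x\<bar>)" using ints by simp
    show "(\<lambda>x. 1 / 2 * (if 0 \<le> g x then q x else p x)) \<in> borel_measurable (leb_on X)"
      by measurable
    show "AE x in leb_on X. norm (1 / 2 * (if 0 \<le> g x then q x else p x)) \<le> norm (\<bar>p x\<bar> + \<bar>q x\<bar>)"
      by (intro AE_I2) simp
  qed
  have "excess_risk X p q f (\<lambda>x. p x - q x) = (\<integral>x. 1 / 2 * (if 0 \<le> f x then q x else p x) \<partial>leb_on X)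
      - (\<integral>x. 1 / 2 * (if 0 \<le> p x - q x then q x else p x) \<partial>leb_on X)"
    unfolding excess_risk_def by (intro arg_cong2[of _ _ _ _ "(-)"] risk_eq[OF X pq]) measurable
  also have "\<dots> = (\<integral>x. 1 / 2 * (if 0 \<le> f x then q x else p x)
      - 1 / 2 * (if 0 \<le> p x - q x then q x else p x) \<partial>leb_on X)"
    by (intro Bochner_Integration.integral_diff[symmetric] int) measurable
  also have "\<dots> = (\<integral>x. 1 / 2 * (if (0 \<le> f x) = (0 \<le> p x - q x) then 0 else \<bar>p x - q x\<bar>) \<partial>leb_on X)"
    by (intro Bochner_Integration.integral_cong) auto
  finally show ?thesis .
qed

section \<open>Networks with one hidden layer\<close>

text \<open>A ridge function: all columns of the first weight matrix except column 0 vanish, so the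
  network reads only \<open>coord 0\<close>. Neuron \<open>j\<close> has input weight
  \<open>w j\<close>, bias \<open>b j\<close> and output weight \<open>v j\<close>.\<close>

definition ridge_params :: "nat \<Rightarrow> nat \<Rightarrow> (nat \<Rightarrow> real) \<Rightarrow> (nat \<Rightarrow> real) \<Rightarrow> (nat \<Rightarrow> real) \<Rightarrow> real \<Rightarrow> relu_params" where
  "ridge_params d r w b v v0 =
     [(Matrix.mat r d (\<lambda>(j, k). if k = 0 then w j else 0), Matrix.vec r b),
      (Matrix.mat 1 r (\<lambda>(i, j). v j), Matrix.vec 1 (\<lambda>_. v0))]"

lemma relu_net_ridge_params:
  fixes x :: "real ^ 'd::finite"
  assumes "0 < r"
  shows "relu_net (ridge_params CARD('d) r w b v v0) x
    = v0 + (\<Sum>j<r. v j * max (w j * vec_nth x (coord 0) + b j) 0)"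
proof -
  have hidden: "(\<Sum>k = 0..<CARD('d). (if k = 0 then w j else 0) * vec_nth x (coord k)) = w j * vec_nth x (coord 0)" for j
    by (subst sum.remove[of _ 0]) auto
  show ?thesis
    using assms hidden
    by (auto simp: relu_net_def ridge_params_def coord_vec_def scalar_prod_def lessThan_atLeast0
        intro!: sum.cong)
qed

lemma ridge_params_max_param:
  assumes "0 \<le> B" "\<bar>v0\<bar> \<le> B" "\<And>j. j < r \<Longrightarrow> \<bar>w j\<bar> \<le> B \<and> \<bar>b j\<bar> \<le> B \<and> \<bar>v j\<bar> \<le> B"
  shows "max_param (ridge_params d r w b v v0) \<le> B"
  unfolding max_param_def
proof (rule Max.boundedI)
  let ?S = "insert 0 (\<Union>(W, b)\<in>set (ridge_params d r w b v v0). abs ` (elements_mat W \<union> vec_set b))"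
  have "finite (elements_mat W)" for W :: "real mat"
    by (simp add: elements_mat_def)
  moreover have "finite (vec_set u)" for u :: "real Matrix.vec"
    by (simp add: vec_set_def)
  ultimately show "finite ?S" by auto
  fix a assume "a \<in> ?S"
  then show "a \<le> B"
    using assms by (auto simp: ridge_params_def elements_mat_def vec_set_def split: if_splits)
qed simp

text \<open>A count of all entries, zero or not: \<open>r * d\<close> and \<open>r\<close> in the
  hidden layer, \<open>r\<close> and 1 in the output layer.\<close>

lemma ridge_params_nonzero_params:
  "nonzero_params (ridge_params d r w b v v0) \<le> r * d + 2 * r + 1"
proof -
  have mat: "card {(i, j). i < dim_row W \<and> j < dim_col W \<and> index_mat W (i, j) \<noteq> 0} \<le> dim_row W * dim_col W"
    for W :: "real mat"
    using card_mono[of "{..<dim_row W} \<times> {..<dim_col W}"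
        "{(i, j). i < dim_row W \<and> j < dim_col W \<and> index_mat W (i, j) \<noteq> 0}"]
    by (auto simp: card_cartesian_product)
  have vec: "card {i. i < dim_vec u \<and> vec_index u i \<noteq> 0} \<le> dim_vec u" for u :: "real Matrix.vec"
    using card_mono[of "{..<dim_vec u}" "{i. i < dim_vec u \<and> vec_index u i \<noteq> 0}"] by auto
  let ?W1 = "Matrix.mat r d (\<lambda>(j, k). if k = 0 then w j else 0)" and ?b1 = "Matrix.vec r b"
  let ?W2 = "Matrix.mat 1 r (\<lambda>(i, j). v j)" and ?b2 = "Matrix.vec 1 (\<lambda>_. v0)"
  have "nonzero_params (ridge_params d r w b v v0)
      = (card {(i, j). i < dim_row ?W1 \<and> j < dim_col ?W1 \<and> index_mat ?W1 (i, j) \<noteq> 0}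
          + card {i. i < dim_vec ?b1 \<and> vec_index ?b1 i \<noteq> 0})
        + (card {(i, j). i < dim_row ?W2 \<and> j < dim_col ?W2 \<and> index_mat ?W2 (i, j) \<noteq> 0}
          + card {i. i < dim_vec ?b2 \<and> vec_index ?b2 i \<noteq> 0})"
    by (simp only: nonzero_params_def ridge_params_def list.map sum_list.Cons sum_list.Nil prod.case add_0_right)
  also have "\<dots> \<le> (dim_row ?W1 * dim_col ?W1 + dim_vec ?b1) + (dim_row ?W2 * dim_col ?W2 + dim_vec ?b2)"
    by (intro add_mono mat vec)
  finally have "nonzero_params (ridge_params d r w b v v0)
      \<le> (dim_row ?W1 * dim_col ?W1 + dim_vec ?b1) + (dim_row ?W2 * dim_col ?W2 + dim_vec ?b2)" .
  then show ?thesis by simp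
qed

lemma ridge_net_in_DNN:
  fixes X :: "(real ^ 'd::finite) set"
  assumes "0 < r" "1 \<le> L" "r \<le> N" "r * CARD('d) + 2 * r + 1 \<le> S"
    and B: "\<bar>v0\<bar> \<le> B" "\<And>j. j < r \<Longrightarrow> \<bar>w j\<bar> \<le> B \<and> \<bar>b j\<bar> \<le> B \<and> \<bar>v j\<bar> \<le> B"
    and f: "\<And>x. f x = v0 + (\<Sum>j<r. v j * max (w j * vec_nth x (coord 0) + b j) 0)"
    and F: "\<And>x. x \<in> X \<Longrightarrow> \<bar>f x\<bar> \<le> F"
  shows "f \<in> DNN X L N S B F"
proof -
  let ?\<theta> = "ridge_params CARD('d) r w b v v0"
  have f_net: "f = relu_net ?\<theta>"
    using assms(1) f by (auto simp: relu_net_ridge_params)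
  have "relu_params_wf ?\<theta> CARD('d)" "hidden_layers ?\<theta> \<le> L" "max_width ?\<theta> \<le> N"
    using assms by (auto simp: ridge_params_def hidden_layers_def max_width_def)
  moreover have "nonzero_params ?\<theta> \<le> S"
    using ridge_params_nonzero_params assms(4) by (rule order_trans)
  moreover have "max_param ?\<theta> \<le> B"
    using B by (intro ridge_params_max_param) (auto intro: order_trans[OF abs_ge_zero])
  moreover have "\<forall>x\<in>X. \<bar>relu_net ?\<theta> x\<bar> \<le> F" using F f_net by auto
  ultimately show ?thesis
    unfolding DNN_def f_net by blast
qed

section \<open>Localised perturbations of a sign change\<close>

text \<open>For \<open>s = \<plusminus>1\<close>, \<open>kink s \<delta>\<close> is the identity plus \<open>s / 2\<close> times the tent function
  \<open>max (\<delta> - \<bar>t\<bar>) 0\<close> on \<open>[-\<delta>, \<delta>]\<close>, and constant outside; \<open>crossing\<close> continues it with slope 1 on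
  the right and slope \<open>\<mu>\<close> on the left. It vanishes at \<open>- s * \<delta> / 3\<close>.\<close>
definition kink :: "real \<Rightarrow> real \<Rightarrow> real \<Rightarrow> real" where
  "kink s \<delta> t = - \<delta> + (1 + s / 2) * max (t + \<delta>) 0 - s * max t 0 + (s / 2 - 1) * max (t - \<delta>) 0"

definition crossing :: "real \<Rightarrow> real \<Rightarrow> real \<Rightarrow> real \<Rightarrow> real" where
  "crossing s \<delta> \<mu> t = kink s \<delta> t + max (t - \<delta>) 0 - \<mu> * max (- t - \<delta>) 0"

text \<open>For either sign the inner slopes are 1/2 and 3/2, so \<open>kink\<close> climbs
  monotonically from -\<delta> to \<delta>.\<close>

lemma kink_bound:
  assumes "0 < \<delta>" "s = 1 \<or> s = -1"
  shows "\<bar>kink s \<delta> t\<bar> \<le> \<delta>"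
  using assms by (auto simp: kink_def max_def abs_le_iff field_simps)

text \<open>The identity cancels and the two half tents add up to the full tent
  \<open>max (\<delta> - \<bar>t\<bar>) 0\<close>.\<close>

lemma kink_diff:
  assumes "0 < \<delta>"
  shows "0 \<le> kink 1 \<delta> t - kink (-1) \<delta> t" "kink 1 \<delta> t - kink (-1) \<delta> t \<le> \<delta>"
    "\<delta> \<le> \<bar>t\<bar> \<Longrightarrow> kink 1 \<delta> t - kink (-1) \<delta> t = 0"
  using assms by (auto simp: kink_def max_def abs_if field_simps split: if_splits)

text \<open>Every slope of \<open>crossing\<close> (\<mu>, then 1/2 and 3/2, then 1) is at least
  \<sigma>, so the function leaves its zero at \<open>- s * \<delta> / 3\<close> at least at that
  rate. This is the source of the margin condition.\<close>

lemma crossing_margin: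
  assumes \<delta>: "0 < \<delta>" and s: "s = 1 \<or> s = -1" and \<sigma>: "0 < \<sigma>" "\<sigma> \<le> 1 / 2" "\<sigma> \<le> \<mu>"
  shows "\<sigma> * \<bar>t + s * \<delta> / 3\<bar> \<le> \<bar>crossing s \<delta> \<mu> t\<bar>"
proof (cases "t \<le> - \<delta>")
  case True
  \<comment> \<open>The zero lies within 2\<delta> of -\<delta>, where the function has already
    dropped to -\<delta>; since \<sigma> is at most 1/2, this drop pays for the inner part of the
    distance.\<close>
  have "\<sigma> * \<bar>t + s * \<delta> / 3\<bar> \<le> \<sigma> * ((- t - \<delta>) + 2 * \<delta>)"
    using True \<delta> s \<sigma> by (intro mult_left_mono) (auto simp: abs_if)
  also have "\<dots> = \<sigma> * (- t - \<delta>) + \<sigma> * (2 * \<delta>)" by (rule distrib_left)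
  also have "\<dots> \<le> \<mu> * (- t - \<delta>) + 1 / 2 * (2 * \<delta>)"
    using True \<delta> \<sigma> by (intro add_mono mult_right_mono) auto
  also have "\<dots> \<le> \<bar>crossing s \<delta> \<mu> t\<bar>"
  proof -
    have "max (t + \<delta>) 0 = 0" "max t 0 = 0" "max (t - \<delta>) 0 = 0" "max (- t - \<delta>) 0 = - t - \<delta>"
      using True \<delta> by auto
    then have "crossing s \<delta> \<mu> t = - (\<mu> * (- t - \<delta>) + \<delta>)"
      by (simp add: crossing_def kink_def)
    then show ?thesis by linarith
  qed
  finally show ?thesis .
next
  case False
  have "\<sigma> * \<bar>t + s * \<delta> / 3\<bar> \<le> 1 / 2 * \<bar>t + s * \<delta> / 3\<bar>"
    using \<sigma> by (intro mult_right_mono) auto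
  also have "\<dots> \<le> \<bar>crossing s \<delta> \<mu> t\<bar>"
    using False \<delta> s by (auto simp: crossing_def kink_def max_def abs_if field_simps)
  finally show ?thesis .
qed

text \<open>The zeros are at -\<delta>/3 and \<delta>/3, outside the middle interval; the smallest
  absolute value on it, at an endpoint, is 5\<delta>/16.\<close>

lemma crossing_sign:
  assumes "0 < \<delta>" "\<bar>t\<bar> \<le> \<delta> / 8"
  shows "\<delta> / 4 \<le> crossing 1 \<delta> \<mu> t" "crossing (-1) \<delta> \<mu> t \<le> - (\<delta> / 4)"
  using assms by (auto simp: crossing_def kink_def max_def abs_if field_simps split: if_splits)

lemma crossing_bound:
  assumes "0 < \<delta>" "s = 1 \<or> s = -1" "0 \<le> \<mu>" "\<mu> \<le> \<Lambda>" "\<bar>t\<bar> \<le> b"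
  shows "\<bar>crossing s \<delta> \<mu> t\<bar> \<le> \<delta> + b + \<Lambda> * b"
proof -
  have "\<bar>crossing s \<delta> \<mu> t\<bar> \<le> \<bar>kink s \<delta> t\<bar> + max (t - \<delta>) 0 + \<mu> * max (- t - \<delta>) 0"
  proof -
    have "0 \<le> \<mu> * max (- t - \<delta>) 0" "0 \<le> max (t - \<delta>) 0" using assms(3) by auto
    then show ?thesis unfolding crossing_def by linarith
  qed
  moreover have "\<mu> * max (- t - \<delta>) 0 \<le> \<Lambda> * b"
    using assms by (intro mult_mono) auto
  moreover have "max (t - \<delta>) 0 \<le> b" using assms by auto
  ultimately show ?thesis using kink_bound[OF assms(1,2), of t] by linarith
qed

text \<open>The two sources of disagreement never overlap: inside the slab only the kinks differ,
  outside it only the left slopes do.\<close>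

lemma crossing_diff_sq:
  assumes "0 < \<delta>" "\<bar>\<mu>1 - \<mu>2\<bar> \<le> e" "\<bar>t\<bar> \<le> b"
  shows "(crossing 1 \<delta> \<mu>1 t - crossing (-1) \<delta> \<mu>2 t)\<^sup>2 \<le> \<delta>\<^sup>2 * (if \<bar>t\<bar> \<le> \<delta> then 1 else 0) + (e * b)\<^sup>2"
proof (cases "\<bar>t\<bar> \<le> \<delta>")
  case True
  then have "crossing 1 \<delta> \<mu>1 t - crossing (-1) \<delta> \<mu>2 t = kink 1 \<delta> t - kink (-1) \<delta> t"
    by (auto simp: crossing_def)
  with True show ?thesis
    using kink_diff[OF assms(1), of t] power_mono[of "kink 1 \<delta> t - kink (-1) \<delta> t" \<delta> 2]
    by (simp add: add_increasing2)
next
  case False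
  then have "crossing 1 \<delta> \<mu>1 t - crossing (-1) \<delta> \<mu>2 t = (\<mu>2 - \<mu>1) * max (- t - \<delta>) 0"
    using kink_diff(3)[OF assms(1), of t] by (simp add: crossing_def algebra_simps)
  moreover have "\<bar>(\<mu>2 - \<mu>1) * max (- t - \<delta>) 0\<bar> \<le> \<bar>e * b\<bar>"
    unfolding abs_mult using assms by (intro mult_mono) auto
  ultimately show ?thesis using False by (simp add: abs_le_square_iff)
qed

text \<open>Pigeonhole: fewer than (v - u)/\<eta> + 1 consecutive windows of width \<eta> cover the
  interval, so one of them receives at least the corresponding share of the increment. The last
  window may extend beyond \<open>v\<close>.\<close>

lemma mono_increment:
  fixes F :: "real \<Rightarrow> real"
  assumes F: "mono F" and uv: "u < v" "0 < \<eta>" "F u + \<Delta> \<le> F v"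
  shows "\<exists>b. u \<le> b \<and> b \<le> v \<and> \<eta> * \<Delta> / (v - u + \<eta>) \<le> F (b + \<eta>) - F b"
proof (rule ccontr)
  define c where "c = \<eta> * \<Delta> / (v - u + \<eta>)"
  assume "\<not> ?thesis"
  then have small: "F (b + \<eta>) - F b < c" if "u \<le> b" "b \<le> v" for b
    using that by (force simp: c_def)
  have c_pos: "0 < c" using small[of u] monoD[OF F, of u "u + \<eta>"] uv by linarith
  \<comment> \<open>The factor \<open>real k - 1\<close> requires only the left end of the last
    window to lie at or before \<open>v\<close>, which is what \<open>small\<close> needs.\<close>
  have step: "F (u + real k * \<eta>) \<le> F u + real k * c" if "(real k - 1) * \<eta> \<le> v - u" for k
    using that
  proof (induction k)
    case (Suc k)
    have "(real k - 1) * \<eta> \<le> real k * \<eta>" using uv by (intro mult_right_mono) auto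
    then have "F (u + real k * \<eta>) \<le> F u + real k * c" using Suc by simp
    moreover have "F (u + real k * \<eta> + \<eta>) - F (u + real k * \<eta>) < c"
      using Suc.prems uv by (intro small) auto
    ultimately show ?case by (simp add: algebra_simps)
  qed simp
  define k where "k = nat \<lceil>(v - u) / \<eta>\<rceil>"
  have k: "(v - u) / \<eta> \<le> real k" "real k < (v - u) / \<eta> + 1"
    using uv unfolding k_def by (auto simp: of_nat_ceiling ceiling_less_iff le_of_int_ceiling) linarith+
  have k1: "v \<le> u + real k * \<eta>" "real k * \<eta> < v - u + \<eta>"
    using k uv by (auto simp: field_simps)
  have "F v \<le> F (u + real k * \<eta>)" using k1 by (intro monoD[OF F])
  also have "\<dots> \<le> F u + real k * c" using k1 by (intro step) (simp add: algebra_simps)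
  also have "real k * c < ((v - u + \<eta>) / \<eta>) * c"
    using k1 uv c_pos by (intro mult_strict_right_mono) (auto simp: field_simps)
  also have "((v - u + \<eta>) / \<eta>) * c = \<Delta>"
    using uv by (simp add: c_def)
  finally show False using uv by simp
qed

text \<open>All that is kept of Lebesgue measure on \<open>X\<close>. The axiom \<open>slab\<close>
  bounds masses from above at every level; a lower bound at a suitable level has to be found, which
  is the task of \<open>exists_crossing_location\<close>.\<close>

locale slab_measure = finite_measure M for M :: "'a measure" +
  fixes \<tau> :: "'a \<Rightarrow> real" and R K :: real
  assumes \<tau>_measurable [measurable]: "\<tau> \<in> borel_measurable M"
    and \<tau>_bounded: "x \<in> space M \<Longrightarrow> \<bar>\<tau> x\<bar> \<le> R"
    and slab: "0 \<le> t \<Longrightarrow> measure M {x \<in> space M. \<bar>\<tau> x - a\<bar> \<le> t} \<le> K * t"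
    and mass_pos: "0 < measure M (space M)"
begin

lemma R_nonneg: "0 \<le> R"
proof -
  have "space M \<noteq> {}" using mass_pos by auto
  then show ?thesis using \<tau>_bounded by force
qed

lemma integrable_comp:
  fixes f :: "real \<Rightarrow> real"
  assumes "continuous_on UNIV f"
  shows "integrable M (\<lambda>x. f (\<tau> x - a))"
proof -
  have "compact (f ` {- R - a..R - a})"
    by (intro compact_continuous_image continuous_on_subset[OF assms]) auto
  then obtain B where B: "\<And>t. t \<in> {- R - a..R - a} \<Longrightarrow> \<bar>f t\<bar> \<le> B"
    by (metis bounded_iff compact_imp_bounded imageI real_norm_def)
  have [measurable]: "f \<in> borel_measurable borel"
    using assms by (rule borel_measurable_continuous_onI)
  show ?thesis
  proof (rule integrable_const_bound[where B = B])
    show "AE x in M. norm (f (\<tau> x - a)) \<le> B"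
    proof (intro AE_I2)
      fix x assume "x \<in> space M"
      then have "\<tau> x - a \<in> {- R - a..R - a}" using \<tau>_bounded[of x] by (auto simp: abs_le_iff)
      then show "norm (f (\<tau> x - a)) \<le> B" using B by simp
    qed
  qed measurable
qed

lemma integrable_kink [simp]: "integrable M (\<lambda>x. kink s \<delta> (\<tau> x - a))"
  by (rule integrable_comp) (auto simp: kink_def intro!: continuous_intros)

lemma integrable_pos_part [simp]: "integrable M (\<lambda>x. max (\<tau> x - a - \<delta>) 0)"
  by (rule integrable_comp[of "\<lambda>t. max (t - \<delta>) 0"]) (intro continuous_intros)

lemma integrable_neg_part [simp]: "integrable M (\<lambda>x. max (a - \<tau> x - \<delta>) 0)"
  using integrable_comp[of "\<lambda>t. max (- t - \<delta>) 0" a] by (simp add: continuous_intros)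

section \<open>The distribution function of the coordinate and the place of the crossing\<close>

definition cdf_\<tau> :: "real \<Rightarrow> real" where
  "cdf_\<tau> s = measure M {x \<in> space M. \<tau> x \<le> s}"

lemma cdf_\<tau>_diff:
  assumes "s \<le> s'"
  shows "cdf_\<tau> s' - cdf_\<tau> s = measure M {x \<in> space M. s < \<tau> x \<and> \<tau> x \<le> s'}"
proof -
  have "cdf_\<tau> s' = cdf_\<tau> s + measure M {x \<in> space M. s < \<tau> x \<and> \<tau> x \<le> s'}"
    unfolding cdf_\<tau>_def using assms
    by (subst finite_measure_Union[symmetric]) (auto intro!: arg_cong[of _ _ "measure M"])
  then show ?thesis by simp
qed

lemma cdf_\<tau>_mono: "mono cdf_\<tau>"
proof (rule monoI)
  fix s s' :: real assume "s \<le> s'"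
  then show "cdf_\<tau> s \<le> cdf_\<tau> s'"
    using cdf_\<tau>_diff[of s s'] measure_nonneg[of M "{x \<in> space M. s < \<tau> x \<and> \<tau> x \<le> s'}"] by linarith
qed

lemma cdf_\<tau>_lipschitz:
  assumes "s \<le> s'"
  shows "cdf_\<tau> s' - cdf_\<tau> s \<le> K * (s' - s)"
proof -
  have "measure M {x \<in> space M. s < \<tau> x \<and> \<tau> x \<le> s'} \<le> measure M {x \<in> space M. \<bar>\<tau> x - s\<bar> \<le> s' - s}"
    by (intro finite_measure_mono) auto
  also have "\<dots> \<le> K * (s' - s)" using assms by (intro slab) auto
  finally show ?thesis using cdf_\<tau>_diff[OF assms] by simp
qed

text \<open>The slab of half-width \<open>R\<close> around 0 is the whole space, which has positive
  mass.\<close>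

lemma K_pos: "0 < K"
proof -
  have "0 < measure M (space M)" by (rule mass_pos)
  also have "measure M (space M) = measure M {x \<in> space M. \<bar>\<tau> x - 0\<bar> \<le> R}"
    using \<tau>_bounded by (intro arg_cong[of _ _ "measure M"]) auto
  also have "\<dots> \<le> K * R" using R_nonneg by (intro slab)
  finally show ?thesis using R_nonneg by (auto simp: zero_less_mult_iff)
qed

lemma cdf_\<tau>_continuous: "continuous_on S cdf_\<tau>"
proof (rule continuous_on_subset[OF lipschitz_on_continuous_on])
  show "K-lipschitz_on UNIV cdf_\<tau>"
  proof (rule lipschitz_onI)
    fix s s' :: real
    show "dist (cdf_\<tau> s) (cdf_\<tau> s') \<le> K * dist s s'"
      using cdf_\<tau>_lipschitz[of s s'] cdf_\<tau>_lipschitz[of s' s] monoD[OF cdf_\<tau>_mono, of s s'] monoD[OF cdf_\<tau>_mono, of s' s]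
      by (cases "s \<le> s'") (auto simp: dist_real_def abs_if)
  qed (use K_pos in auto)
qed simp

lemma cdf_\<tau>_ends:
  assumes "R < b"
  shows "cdf_\<tau> (- b) = 0" "cdf_\<tau> b = measure M (space M)"
proof -
  have *: "{x \<in> space M. \<tau> x \<le> - b} = {}" "{x \<in> space M. \<tau> x \<le> b} = space M"
    using \<tau>_bounded assms by (force simp: abs_le_iff)+
  show "cdf_\<tau> (- b) = 0" "cdf_\<tau> b = measure M (space M)"
    by (simp_all only: cdf_\<tau>_def * measure_empty)
qed

text \<open>The slab bound excludes atoms, so the distribution function is continuous and attains
  every intermediate level.\<close>

lemma cdf_\<tau>_quantile:
  assumes "0 < y" "y < measure M (space M)"
  obtains u where "\<bar>u\<bar> \<le> R + 1" "cdf_\<tau> u = y"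
proof -
  have "\<exists>u\<ge>- (R + 1). u \<le> R + 1 \<and> cdf_\<tau> u = y"
    using assms R_nonneg cdf_\<tau>_ends[of "R + 1"]
    by (intro IVT' cdf_\<tau>_continuous) auto
  then obtain u where "- (R + 1) \<le> u" "u \<le> R + 1" "cdf_\<tau> u = y" by blast
  then show ?thesis by (intro that[of u]) (auto simp: abs_le_iff)
qed

text \<open>Between the tertiles of \<tau> the pigeonhole argument finds a window whose mass is of
  order \<delta>, and a third of the total mass remains on either side of the tertiles. The two
  integrals bounded below by \<open>D0\<close> become numerator term and denominator of the left
  slope, so \<open>D0\<close> has to be free of \<delta>.\<close>

lemma exists_crossing_location:
  obtains D0 \<kappa> \<delta>0 where "0 < D0" "0 < \<kappa>" "0 < \<delta>0" "\<delta>0 \<le> 1"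
    "\<forall>\<delta>. 0 < \<delta> \<and> \<delta> \<le> \<delta>0 \<longrightarrow> (\<exists>a. \<bar>a\<bar> \<le> R + 2 \<and>
       \<kappa> * \<delta> \<le> measure M {x \<in> space M. \<bar>\<tau> x - a\<bar> \<le> \<delta> / 8} \<and>
       D0 \<le> (\<integral>x. max (\<tau> x - a - \<delta>) 0 \<partial>M) \<and> D0 \<le> (\<integral>x. max (a - \<tau> x - \<delta>) 0 \<partial>M))"
proof -
  define m where "m = measure M (space M)"
  have m: "0 < m" using mass_pos by (simp add: m_def)
  obtain u where u: "\<bar>u\<bar> \<le> R + 1" "cdf_\<tau> u = m / 3"
    using cdf_\<tau>_quantile[of "m / 3"] m by (auto simp: m_def)
  obtain v where v: "\<bar>v\<bar> \<le> R + 1" "cdf_\<tau> v = 2 * m / 3"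
    using cdf_\<tau>_quantile[of "2 * m / 3"] m by (auto simp: m_def)
  have uv: "u < v"
    using monoD[OF cdf_\<tau>_mono, of v u] u v m by (cases "u < v") auto
  \<comment> \<open>Moving outwards from a tertile by \<rho> costs at most half of the outer third,
    so m/6 remains. There the integrands are at least \<rho> - \<rho>/4 - \<rho>/4, which gives
    \<open>D0\<close>. The value of \<kappa> is the pigeonhole share of m/3 for windows of width
    \<delta>/4, with v - u + \<delta>/4 at most 2R + 3.\<close>
  define \<rho> where "\<rho> = m / (6 * K)"
  have \<rho>: "0 < \<rho>" "K * \<rho> = m / 6" using m K_pos by (auto simp: \<rho>_def)
  define D0 where "D0 = \<rho> / 2 * (m / 6)"
  define \<kappa> where "\<kappa> = m / (12 * (2 * R + 3))"
  define \<delta>0 where "\<delta>0 = min 1 (\<rho> / 4)"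
  have lower: "D0 \<le> (\<integral>x. g x \<partial>M)"
    if A: "A \<in> sets M" "m / 6 \<le> measure M A" and g: "integrable M g" "\<And>x. x \<in> space M \<Longrightarrow> 0 \<le> g x"
      "\<And>x. x \<in> A \<Longrightarrow> \<rho> / 2 \<le> g x" for A g
  proof -
    have "D0 \<le> \<rho> / 2 * measure M A"
      unfolding D0_def using A \<rho> by (intro mult_left_mono) auto
    also have "\<dots> = (\<integral>x. \<rho> / 2 * indicator A x \<partial>M)"
      using A(1) by (simp add: Int_absorb2 sets.sets_into_space)
    also have "\<dots> \<le> (\<integral>x. g x \<partial>M)"
    proof (rule integral_mono)
      show "integrable M (\<lambda>x. \<rho> / 2 * indicator A x)"
        using A(1) by (intro Bochner_Integration.integrable_mult_right integrable_real_indicator)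
          (auto simp: emeasure_eq_measure)
    qed (use g in \<open>auto simp: indicator_def\<close>)
    finally show ?thesis .
  qed
  show ?thesis
  proof (rule that[of D0 \<kappa> \<delta>0])
    show "0 < D0" "0 < \<kappa>" "0 < \<delta>0" "\<delta>0 \<le> 1"
      using m \<rho> R_nonneg by (auto simp: D0_def \<kappa>_def \<delta>0_def)
  next
    show "\<forall>\<delta>. 0 < \<delta> \<and> \<delta> \<le> \<delta>0 \<longrightarrow> (\<exists>a. \<bar>a\<bar> \<le> R + 2 \<and>
       \<kappa> * \<delta> \<le> measure M {x \<in> space M. \<bar>\<tau> x - a\<bar> \<le> \<delta> / 8} \<and>
       D0 \<le> (\<integral>x. max (\<tau> x - a - \<delta>) 0 \<partial>M) \<and> D0 \<le> (\<integral>x. max (a - \<tau> x - \<delta>) 0 \<partial>M))"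
    proof (intro allI impI, elim conjE)
      fix \<delta> assume \<delta>: "0 < \<delta>" "\<delta> \<le> \<delta>0"
      have \<delta>1: "\<delta> \<le> 1" "\<delta> \<le> \<rho> / 4" using \<delta> by (auto simp: \<delta>0_def)
      obtain b where b: "u \<le> b" "b \<le> v"
        "\<delta> / 4 * (m / 3) / (v - u + \<delta> / 4) \<le> cdf_\<tau> (b + \<delta> / 4) - cdf_\<tau> b"
        using mono_increment[OF cdf_\<tau>_mono uv, of "\<delta> / 4" "m / 3"] u v \<delta> by auto
      \<comment> \<open>The midpoint of the window found, so that the window lies in the slab of
        half-width \<delta>/8.\<close>
      define a where "a = b + \<delta> / 8"
      have ab: "u \<le> a" "a \<le> v + \<rho> / 4" using b \<delta> \<delta>1 by (auto simp: a_def)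
      have "\<bar>a\<bar> \<le> R + 2" using b u v \<delta> \<delta>1 by (auto simp: a_def abs_le_iff)
      moreover have "\<kappa> * \<delta> \<le> measure M {x \<in> space M. \<bar>\<tau> x - a\<bar> \<le> \<delta> / 8}"
      proof -
        have "\<kappa> * \<delta> = \<delta> / 4 * (m / 3) / (2 * R + 3)"
          using R_nonneg by (simp add: \<kappa>_def field_simps)
        also have "\<dots> \<le> \<delta> / 4 * (m / 3) / (v - u + \<delta> / 4)"
          using u v \<delta> \<delta>1 m uv by (intro divide_left_mono mult_pos_pos) (auto simp: abs_le_iff)
        also have "\<dots> \<le> measure M {x \<in> space M. b < \<tau> x \<and> \<tau> x \<le> b + \<delta> / 4}"
          using b(3) cdf_\<tau>_diff[of b "b + \<delta> / 4"] \<delta> by simp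
        also have "\<dots> \<le> measure M {x \<in> space M. \<bar>\<tau> x - a\<bar> \<le> \<delta> / 8}"
          by (intro finite_measure_mono) (auto simp: a_def abs_if field_simps)
        finally show ?thesis .
      qed
      moreover have "D0 \<le> (\<integral>x. max (\<tau> x - a - \<delta>) 0 \<partial>M)"
      \<comment> \<open>The upper limit exceeds \<open>R\<close> and cuts nothing off; it only makes
        the mass of the set a difference of two values of \<open>cdf_\<tau>\<close>.\<close>
      proof (rule lower[of "{x \<in> space M. v + \<rho> < \<tau> x \<and> \<tau> x \<le> R + \<rho> + \<bar>v\<bar> + 1}"])
        let ?A = "{x \<in> space M. v + \<rho> < \<tau> x \<and> \<tau> x \<le> R + \<rho> + \<bar>v\<bar> + 1}"
        have "measure M ?A = m - cdf_\<tau> (v + \<rho>)"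
          using cdf_\<tau>_diff[of "v + \<rho>" "R + \<rho> + \<bar>v\<bar> + 1"] cdf_\<tau>_ends(2)[of "R + \<rho> + \<bar>v\<bar> + 1"] \<rho> R_nonneg
          by (auto simp: m_def)
        then show "m / 6 \<le> measure M ?A"
          using cdf_\<tau>_lipschitz[of v "v + \<rho>"] \<rho> v by simp
      qed (use ab \<delta>1 \<rho> in auto)
      moreover have "D0 \<le> (\<integral>x. max (a - \<tau> x - \<delta>) 0 \<partial>M)"
      proof (rule lower[of "{x \<in> space M. \<tau> x \<le> u - \<rho>}"])
        show "m / 6 \<le> measure M {x \<in> space M. \<tau> x \<le> u - \<rho>}"
          using cdf_\<tau>_lipschitz[of "u - \<rho>" u] \<rho> u unfolding cdf_\<tau>_def by simp
      qed (use ab \<delta>1 \<rho> in auto)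
      ultimately show "\<exists>a. \<bar>a\<bar> \<le> R + 2 \<and>
         \<kappa> * \<delta> \<le> measure M {x \<in> space M. \<bar>\<tau> x - a\<bar> \<le> \<delta> / 8} \<and>
         D0 \<le> (\<integral>x. max (\<tau> x - a - \<delta>) 0 \<partial>M) \<and> D0 \<le> (\<integral>x. max (a - \<tau> x - \<delta>) 0 \<partial>M)"
        by blast
    qed
  qed
qed

section \<open>Left slopes for which both contrasts have mean zero\<close>

lemma crossing_split:
  "integrable M (\<lambda>x. crossing s \<delta> \<mu> (\<tau> x - a))"
  "(\<integral>x. crossing s \<delta> \<mu> (\<tau> x - a) \<partial>M) = (\<integral>x. kink s \<delta> (\<tau> x - a) \<partial>M)
     + (\<integral>x. max (\<tau> x - a - \<delta>) 0 \<partial>M) - \<mu> * (\<integral>x. max (a - \<tau> x - \<delta>) 0 \<partial>M)"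
  unfolding crossing_def by simp_all

lemma integrable_indicator_le:
  "integrable M (\<lambda>x. if \<bar>\<tau> x - a\<bar> \<le> t then 1 else 0 :: real)"
  "(\<integral>x. (if \<bar>\<tau> x - a\<bar> \<le> t then 1 else 0) \<partial>M) = measure M {x \<in> space M. \<bar>\<tau> x - a\<bar> \<le> t}"
proof -
  have eq: "(if \<bar>\<tau> x - a\<bar> \<le> t then 1 else 0 :: real) = indicator {x \<in> space M. \<bar>\<tau> x - a\<bar> \<le> t} x"
    if "x \<in> space M" for x
    using that by (simp add: indicator_def)
  show "integrable M (\<lambda>x. if \<bar>\<tau> x - a\<bar> \<le> t then 1 else 0 :: real)"
    by (rule integrable_const_bound[where B = 1]) auto
  show "(\<integral>x. (if \<bar>\<tau> x - a\<bar> \<le> t then 1 else 0) \<partial>M) = measure M {x \<in> space M. \<bar>\<tau> x - a\<bar> \<le> t}"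
    by (subst Bochner_Integration.integral_cong[OF refl eq]) (auto simp: Int_absorb2)
qed

text \<open>The mean of a crossing is affine in its left slope, so it vanishes for exactly one
  slope, (H s + E)/D. Both hypotheses share the centre and hence \<open>E\<close> and
  \<open>D\<close>; their slopes differ only through \<open>H\<close>, that is, through the integral
  of the tent.\<close>

lemma two_crossings:
  obtains \<sigma> \<Lambda> \<kappa> C \<delta>0 where "0 < \<sigma>" "\<sigma> \<le> 1 / 2" "0 < \<Lambda>" "0 < \<kappa>" "0 < C" "0 < \<delta>0" "\<delta>0 \<le> 1"
    "\<forall>\<delta>. 0 < \<delta> \<and> \<delta> \<le> \<delta>0 \<longrightarrow> (\<exists>a \<mu>1 \<mu>2. \<bar>a\<bar> \<le> R + 2 \<and>
       \<kappa> * \<delta> \<le> measure M {x \<in> space M. \<bar>\<tau> x - a\<bar> \<le> \<delta> / 8} \<and>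
       \<sigma> \<le> \<mu>1 \<and> \<mu>1 \<le> \<Lambda> \<and> \<sigma> \<le> \<mu>2 \<and> \<mu>2 \<le> \<Lambda> \<and>
       (\<integral>x. crossing 1 \<delta> \<mu>1 (\<tau> x - a) \<partial>M) = 0 \<and> (\<integral>x. crossing (-1) \<delta> \<mu>2 (\<tau> x - a) \<partial>M) = 0 \<and>
       (\<integral>x. (crossing 1 \<delta> \<mu>1 (\<tau> x - a) - crossing (-1) \<delta> \<mu>2 (\<tau> x - a))\<^sup>2 \<partial>M) \<le> C * \<delta> ^ 3)"
proof -
  obtain D0 \<kappa> \<delta>1 where D0: "0 < D0" "0 < \<kappa>" "0 < \<delta>1" "\<delta>1 \<le> 1"
    and loc: "\<forall>\<delta>. 0 < \<delta> \<and> \<delta> \<le> \<delta>1 \<longrightarrow> (\<exists>a. \<bar>a\<bar> \<le> R + 2 \<and>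
       \<kappa> * \<delta> \<le> measure M {x \<in> space M. \<bar>\<tau> x - a\<bar> \<le> \<delta> / 8} \<and>
       D0 \<le> (\<integral>x. max (\<tau> x - a - \<delta>) 0 \<partial>M) \<and> D0 \<le> (\<integral>x. max (a - \<tau> x - \<delta>) 0 \<partial>M))"
    by (rule exists_crossing_location)
  define m where "m = measure M (space M)"
  have m: "0 < m" using mass_pos by (simp add: m_def)
  define b where "b = 2 * R + 2"
  have b: "0 < b" using R_nonneg by (simp add: b_def)
  \<comment> \<open>Extreme values of (H s + E)/D: the numerator lies between D0/2 and m + b m, the
    denominator between D0 and b m. The cap 1/2 is the one \<open>crossing_margin\<close> asks
    for.\<close>
  define \<sigma> where "\<sigma> = min (1 / 2) (D0 / 2 / (b * m))"
  define \<Lambda> where "\<Lambda> = (m + b * m) / D0"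
  \<comment> \<open>The first term comes from the tent on its slab, the second from the difference
    of the slopes on the whole space.\<close>
  define C where "C = K + (K * b / D0)\<^sup>2 * m"
  \<comment> \<open>Makes \<bar>H s\<bar> at most D0/2, so that it cannot cancel \<open>E\<close>
    and the slope stays positive.\<close>
  define \<delta>0 where "\<delta>0 = min \<delta>1 (D0 / (2 * m))"
  show ?thesis
  proof (rule that[of \<sigma> \<Lambda> \<kappa> C \<delta>0])
    show "0 < \<sigma>" "\<sigma> \<le> 1 / 2" "0 < \<Lambda>" "0 < \<kappa>" "0 < \<delta>0" "\<delta>0 \<le> 1"
      using m b D0 by (auto simp: \<sigma>_def \<Lambda>_def \<delta>0_def add_pos_pos)
    show "0 < C"
      unfolding C_def using K_pos m by (intro add_pos_nonneg) auto
  next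
    show "\<forall>\<delta>. 0 < \<delta> \<and> \<delta> \<le> \<delta>0 \<longrightarrow> (\<exists>a \<mu>1 \<mu>2. \<bar>a\<bar> \<le> R + 2 \<and>
       \<kappa> * \<delta> \<le> measure M {x \<in> space M. \<bar>\<tau> x - a\<bar> \<le> \<delta> / 8} \<and>
       \<sigma> \<le> \<mu>1 \<and> \<mu>1 \<le> \<Lambda> \<and> \<sigma> \<le> \<mu>2 \<and> \<mu>2 \<le> \<Lambda> \<and>
       (\<integral>x. crossing 1 \<delta> \<mu>1 (\<tau> x - a) \<partial>M) = 0 \<and> (\<integral>x. crossing (-1) \<delta> \<mu>2 (\<tau> x - a) \<partial>M) = 0 \<and>
       (\<integral>x. (crossing 1 \<delta> \<mu>1 (\<tau> x - a) - crossing (-1) \<delta> \<mu>2 (\<tau> x - a))\<^sup>2 \<partial>M) \<le> C * \<delta> ^ 3)"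
    proof (intro allI impI, elim conjE)
      fix \<delta> assume \<delta>: "0 < \<delta>" "\<delta> \<le> \<delta>0"
      then have \<delta>1: "\<delta> \<le> \<delta>1" "\<delta> * m \<le> D0 / 2" "\<delta> \<le> 1"
        using m D0 by (auto simp: \<delta>0_def field_simps)
      obtain a where a: "\<bar>a\<bar> \<le> R + 2" "\<kappa> * \<delta> \<le> measure M {x \<in> space M. \<bar>\<tau> x - a\<bar> \<le> \<delta> / 8}"
        and ED: "D0 \<le> (\<integral>x. max (\<tau> x - a - \<delta>) 0 \<partial>M)" "D0 \<le> (\<integral>x. max (a - \<tau> x - \<delta>) 0 \<partial>M)"
        using loc[rule_format, of \<delta>] \<delta> \<delta>1 by blast
      define E where "E = (\<integral>x. max (\<tau> x - a - \<delta>) 0 \<partial>M)"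
      define D where "D = (\<integral>x. max (a - \<tau> x - \<delta>) 0 \<partial>M)"
      define H where "H s = (\<integral>x. kink s \<delta> (\<tau> x - a) \<partial>M)" for s
      define \<mu> where "\<mu> s = (H s + E) / D" for s
      have \<tau>b: "\<bar>\<tau> x - a\<bar> \<le> b" if "x \<in> space M" for x
        using \<tau>_bounded[OF that] a(1) by (simp add: b_def)
      have le_const: "(\<integral>x. g x \<partial>M) \<le> B * m" if "integrable M g" "\<And>x. x \<in> space M \<Longrightarrow> g x \<le> B" for g B
        using integral_mono[OF that(1) integrable_const that(2)] by (simp add: m_def mult.commute)
      have E: "D0 \<le> E" "E \<le> b * m" and D: "D0 \<le> D" "D \<le> b * m"
      proof -
        show "D0 \<le> E" "D0 \<le> D" unfolding E_def D_def by (rule ED)+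
        have "max (\<tau> x - a - \<delta>) 0 \<le> b \<and> max (a - \<tau> x - \<delta>) 0 \<le> b" if "x \<in> space M" for x
          using \<tau>b[OF that] b \<delta> by (auto simp: abs_le_iff)
        then show "E \<le> b * m" "D \<le> b * m"
          unfolding E_def D_def by (auto intro!: le_const)
      qed
      have Dp: "0 < D" using D D0 by simp
      have H: "\<bar>H s\<bar> \<le> \<delta> * m" if s: "s = 1 \<or> s = -1" for s
      proof -
        have "\<bar>H s\<bar> \<le> (\<integral>x. \<bar>kink s \<delta> (\<tau> x - a)\<bar> \<partial>M)"
          unfolding H_def by (rule integral_abs_bound)
        also have "\<dots> \<le> \<delta> * m" using kink_bound[OF \<delta>(1) s] by (intro le_const) auto
        finally show ?thesis .
      qed
      have \<mu>: "\<sigma> \<le> \<mu> s" "\<mu> s \<le> \<Lambda>" if s: "s = 1 \<or> s = -1" for s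
      proof -
        have "D0 / 2 \<le> H s + E" using H[OF s] E \<delta>1 by linarith
        then have "D0 / 2 / (b * m) \<le> (H s + E) / D"
          using D D0 Dp b m by (intro frac_le) auto
        then show "\<sigma> \<le> \<mu> s" by (simp add: \<sigma>_def \<mu>_def)
        have "\<delta> * m \<le> 1 * m" using \<delta>1 m by (intro mult_right_mono) auto
        then have "H s + E \<le> m + b * m" using H[OF s] E by linarith
        then show "\<mu> s \<le> \<Lambda>"
          unfolding \<mu>_def \<Lambda>_def using D D0 b m by (intro frac_le) auto
      qed
      have zero: "(\<integral>x. crossing s \<delta> (\<mu> s) (\<tau> x - a) \<partial>M) = 0" for s
        unfolding crossing_split using Dp by (simp add: \<mu>_def H_def[symmetric] E_def[symmetric] D_def[symmetric])
      define S where "S = measure M {x \<in> space M. \<bar>\<tau> x - a\<bar> \<le> \<delta>}"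
      have S: "S \<le> K * \<delta>" unfolding S_def using \<delta> by (intro slab) auto
      \<comment> \<open>The tent has height \<delta> and lives on a slab of mass at most K\<delta>;
        this is why the slopes differ only by O(\<delta>^2).\<close>
      have Hd: "\<bar>H 1 - H (-1)\<bar> \<le> \<delta> * S"
      proof -
        have "H 1 - H (-1) = (\<integral>x. kink 1 \<delta> (\<tau> x - a) - kink (-1) \<delta> (\<tau> x - a) \<partial>M)"
          unfolding H_def by simp
        moreover have "0 \<le> (\<integral>x. kink 1 \<delta> (\<tau> x - a) - kink (-1) \<delta> (\<tau> x - a) \<partial>M)"
          by (rule Bochner_Integration.integral_nonneg) (rule kink_diff(1)[OF \<delta>(1)])
        moreover have "(\<integral>x. kink 1 \<delta> (\<tau> x - a) - kink (-1) \<delta> (\<tau> x - a) \<partial>M)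
            \<le> (\<integral>x. \<delta> * (if \<bar>\<tau> x - a\<bar> \<le> \<delta> then 1 else 0) \<partial>M)"
          using kink_diff[OF \<delta>(1)]
          by (intro integral_mono) (auto intro!: integrable_indicator_le Bochner_Integration.integrable_diff
              Bochner_Integration.integrable_mult_right)
        ultimately show ?thesis by (simp add: integrable_indicator_le S_def)
      qed
      have \<mu>d: "\<bar>\<mu> 1 - \<mu> (-1)\<bar> \<le> K * \<delta>\<^sup>2 / D0"
      proof -
        have "\<bar>\<mu> 1 - \<mu> (-1)\<bar> = \<bar>H 1 - H (-1)\<bar> / D"
          using Dp by (simp add: \<mu>_def diff_divide_distrib[symmetric])
        also have "\<dots> \<le> (\<delta> * (K * \<delta>)) / D0"
        proof (rule frac_le)
          have "\<delta> * S \<le> \<delta> * (K * \<delta>)" using S \<delta> by (intro mult_left_mono) auto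
          then show "\<bar>H 1 - H (-1)\<bar> \<le> \<delta> * (K * \<delta>)" using Hd by (rule order_trans[rotated])
        qed (use \<delta> D D0 K_pos in auto)
        finally show ?thesis by (simp add: power2_eq_square mult_ac)
      qed
      have "(\<integral>x. (crossing 1 \<delta> (\<mu> 1) (\<tau> x - a) - crossing (-1) \<delta> (\<mu> (-1)) (\<tau> x - a))\<^sup>2 \<partial>M)
         \<le> (\<integral>x. \<delta>\<^sup>2 * (if \<bar>\<tau> x - a\<bar> \<le> \<delta> then 1 else 0) + (K * \<delta>\<^sup>2 / D0 * b)\<^sup>2 \<partial>M)"
      proof (rule integral_mono)
        show "integrable M (\<lambda>x. (crossing 1 \<delta> (\<mu> 1) (\<tau> x - a) - crossing (-1) \<delta> (\<mu> (-1)) (\<tau> x - a))\<^sup>2)"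
          by (rule integrable_comp[of "\<lambda>t. (crossing 1 \<delta> (\<mu> 1) t - crossing (-1) \<delta> (\<mu> (-1)) t)\<^sup>2"])
            (unfold crossing_def kink_def, intro continuous_intros)
      qed (use crossing_diff_sq[OF \<delta>(1) \<mu>d \<tau>b] in
          \<open>auto intro!: integrable_indicator_le Bochner_Integration.integrable_mult_right\<close>)
      also have "\<dots> = \<delta>\<^sup>2 * S + (K * \<delta>\<^sup>2 / D0 * b)\<^sup>2 * m"
        by (subst Bochner_Integration.integral_add)
          (auto intro!: integrable_indicator_le Bochner_Integration.integrable_mult_right
            simp: integrable_indicator_le S_def m_def)
      also have "\<dots> \<le> \<delta>\<^sup>2 * (K * \<delta>) + (K * b / D0)\<^sup>2 * m * \<delta> ^ 4"
      proof (rule add_mono)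
        show "\<delta>\<^sup>2 * S \<le> \<delta>\<^sup>2 * (K * \<delta>)" using S by (intro mult_left_mono) auto
        show "(K * \<delta>\<^sup>2 / D0 * b)\<^sup>2 * m \<le> (K * b / D0)\<^sup>2 * m * \<delta> ^ 4"
          by (simp add: power2_eq_square power4_eq_xxxx mult_ac)
      qed
      also have "\<dots> \<le> \<delta>\<^sup>2 * (K * \<delta>) + (K * b / D0)\<^sup>2 * m * \<delta> ^ 3"
        using \<delta> \<delta>1 m K_pos by (intro add_mono mult_left_mono power_decreasing) auto
      also have "\<dots> = C * \<delta> ^ 3"
        by (simp add: C_def algebra_simps power2_eq_square power3_eq_cube)
      finally show "\<exists>a \<mu>1 \<mu>2. \<bar>a\<bar> \<le> R + 2 \<and>
         \<kappa> * \<delta> \<le> measure M {x \<in> space M. \<bar>\<tau> x - a\<bar> \<le> \<delta> / 8} \<and>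
         \<sigma> \<le> \<mu>1 \<and> \<mu>1 \<le> \<Lambda> \<and> \<sigma> \<le> \<mu>2 \<and> \<mu>2 \<le> \<Lambda> \<and>
         (\<integral>x. crossing 1 \<delta> \<mu>1 (\<tau> x - a) \<partial>M) = 0 \<and> (\<integral>x. crossing (-1) \<delta> \<mu>2 (\<tau> x - a) \<partial>M) = 0 \<and>
         (\<integral>x. (crossing 1 \<delta> \<mu>1 (\<tau> x - a) - crossing (-1) \<delta> \<mu>2 (\<tau> x - a))\<^sup>2 \<partial>M) \<le> C * \<delta> ^ 3"
        using a \<mu> zero by blast
    qed
  qed
qed

end

text \<open>\<open>X\<close> lies in a box, so its part in a slab lies in a box of width 2t in
  direction \<open>i\<close> and fixed sides otherwise; the volume of that box is linear in
  \<open>t\<close>.\<close>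

lemma slab_measure_leb_on:
  fixes X :: "(real ^ 'd::finite) set"
  assumes X: "X \<in> sets borel" "bounded X" "0 < emeasure lborel X"
  obtains R K where "slab_measure (leb_on X) (\<lambda>x. vec_nth x i) R K"
proof -
  obtain a where a: "X \<subseteq> cbox (- a) a"
    using bounded_subset_cbox_symmetric[OF X(2)] by auto
  have a_bound: "\<bar>vec_nth x j\<bar> \<le> vec_nth a j" if "x \<in> X" for x j
  proof -
    have "vec_nth (- a) j \<le> vec_nth x j \<and> vec_nth x j \<le> vec_nth a j"
      using a that by (auto simp only: mem_box_cart subset_iff)
    then show ?thesis by auto
  qed
  have a0: "0 \<le> vec_nth a j" for j
  proof -
    obtain x where "x \<in> X" using X(3) by (cases "X = {}") auto
    then show ?thesis using a_bound[of x j] by linarith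
  qed
  define K where "K = 2 * (\<Prod>j\<in>UNIV - {i}. 2 * vec_nth a j)"
  interpret finite_measure "leb_on X" using finite_measure_leb_on[OF X(1,2)] .
  have "slab_measure (leb_on X) (\<lambda>x. vec_nth x i) (vec_nth a i) K"
  proof unfold_locales
    show "(\<lambda>x. vec_nth x i) \<in> borel_measurable (leb_on X)"
      by (intro measurable_restrict_space1) simp
    show "\<bar>vec_nth x i\<bar> \<le> vec_nth a i" if "x \<in> space (leb_on X)" for x
      using that a_bound by (simp add: space_leb_on)
    show "0 < measure (leb_on X) (space (leb_on X))"
      using X emeasure_bounded_finite[OF X(2)]
      by (simp add: space_leb_on emeasure_restrict_space measure_def enn2real_positive_iff)
    fix t c :: real assume t: "0 \<le> t"
    define l u :: "real ^ 'd" where "l = (\<chi> j. if j = i then c - t else - vec_nth a j)"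
      and "u = (\<chi> j. if j = i then c + t else vec_nth a j)"
    let ?S = "{x \<in> X. \<bar>vec_nth x i - c\<bar> \<le> t}"
    have "?S = X \<inter> {x. \<bar>vec_nth x i - c\<bar> \<le> t}" by auto
    moreover have "{x. \<bar>vec_nth x i - c\<bar> \<le> t} \<in> sets borel" by simp
    ultimately have S: "?S \<in> sets lborel" using X(1) by auto
    have sub: "?S \<subseteq> cbox l u"
      using a_bound by (auto simp: mem_box_cart l_def u_def abs_le_iff minus_le_iff)
    have "measure (leb_on X) ?S = measure lborel ?S"
      using X(1) by (intro measure_restrict_space) auto
    also have "\<dots> \<le> measure lborel (cbox l u)"
      using S sub by (intro measure_mono_fmeasurable) auto
    also have "\<dots> = (\<Prod>j\<in>UNIV. vec_nth u j - vec_nth l j)"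
      using t a0 by (intro content_cbox_cart) (auto simp: interval_ne_empty_cart l_def u_def intro: order_trans[of _ 0])
    also have "\<dots> = K * t"
      by (subst prod.remove[of _ i]) (auto simp: K_def l_def u_def intro!: prod.cong)
    finally show "measure (leb_on X) {x \<in> space (leb_on X). \<bar>vec_nth x i - c\<bar> \<le> t} \<le> K * t"
      by (simp add: space_leb_on)
  qed
  then show ?thesis by (rule that)
qed

section \<open>The two hypotheses\<close>

lemma DNN_mono:
  assumes "f \<in> DNN X L N S B F" "L \<le> L'" "N \<le> N'" "S \<le> S'" "B \<le> B'" "F \<le> F'"
  shows "f \<in> DNN X L' N' S' B' F'"
  using assms unfolding DNN_def by fastforce

text \<open>Three breakpoints, but four neurons: the two terms of \<open>crossing\<close> with
  argument t - \<delta> merge into one of weight \<open>s / 2\<close>, and the left slope needs a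
  neuron with input weight -1. In the parameter bound, \<open>R + 2\<close> serves input weights and
  biases, the rest the output layer.\<close>

lemma crossing_in_DNN:
  fixes X :: "(real ^ 'd::finite) set"
  assumes \<delta>: "0 < \<delta>" "\<delta> \<le> 1" and s: "s = 1 \<or> s = -1" and \<mu>: "0 \<le> \<mu>" "\<mu> \<le> \<Lambda>" and a: "\<bar>a\<bar> \<le> R"
    and \<epsilon>: "0 \<le> \<epsilon>"
    and F: "\<And>x. x \<in> X \<Longrightarrow> \<bar>\<epsilon> * crossing s \<delta> \<mu> (vec_nth x (coord 0) - a)\<bar> \<le> F"
  shows "(\<lambda>x. \<epsilon> * crossing s \<delta> \<mu> (vec_nth x (coord 0) - a))
    \<in> DNN X 1 4 (4 * CARD('d) + 9) (R + 2 + \<epsilon> * (2 + \<Lambda>)) F"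
proof -
  let ?w = "\<lambda>j::nat. if j = 3 then -1 else 1 :: real"
  let ?b = "(\<lambda>j::nat. if j = 0 then \<delta> - a else if j = 1 then - a else if j = 2 then - a - \<delta> else a - \<delta>)"
  let ?v = "(\<lambda>j::nat. if j = 0 then \<epsilon> * (1 + s / 2) else if j = 1 then - (\<epsilon> * s)
      else if j = 2 then \<epsilon> * (s / 2) else - (\<epsilon> * \<mu>))"
  have coeff: "\<bar>\<epsilon> * c\<bar> \<le> R + 2 + \<epsilon> * (2 + \<Lambda>)" if "\<bar>c\<bar> \<le> 2 + \<Lambda>" for c
  proof -
    have "\<bar>\<epsilon> * c\<bar> \<le> \<epsilon> * (2 + \<Lambda>)" using that \<epsilon> by (simp add: abs_mult mult_left_mono)
    then show ?thesis using a by linarith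
  qed
  have pos: "0 \<le> \<epsilon> * (2 + \<Lambda>)" using \<epsilon> \<mu> by simp
  show ?thesis
  proof (rule ridge_net_in_DNN[where w = ?w and b = ?b and v = ?v and ?v0.0 = "- (\<epsilon> * \<delta>)" and r = 4])
    show "\<bar>- (\<epsilon> * \<delta>)\<bar> \<le> R + 2 + \<epsilon> * (2 + \<Lambda>)"
      using coeff[of \<delta>] \<delta> \<mu> by simp
    fix j :: nat assume "j < 4"
    have "\<bar>?w j\<bar> \<le> R + 2 + \<epsilon> * (2 + \<Lambda>)" "\<bar>?b j\<bar> \<le> R + 2 + \<epsilon> * (2 + \<Lambda>)"
      using a pos \<delta> by auto
    moreover have "\<bar>?v j\<bar> \<le> R + 2 + \<epsilon> * (2 + \<Lambda>)"
      using coeff[of "1 + s / 2"] coeff[of s] coeff[of "s / 2"] coeff[of \<mu>] s \<mu> by auto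
    ultimately show "\<bar>?w j\<bar> \<le> R + 2 + \<epsilon> * (2 + \<Lambda>) \<and> \<bar>?b j\<bar> \<le> R + 2 + \<epsilon> * (2 + \<Lambda>) \<and> \<bar>?v j\<bar> \<le> R + 2 + \<epsilon> * (2 + \<Lambda>)"
      by blast
  next
    fix x :: "real ^ 'd"
    show "\<epsilon> * crossing s \<delta> \<mu> (vec_nth x (coord 0) - a)
        = - (\<epsilon> * \<delta>) + (\<Sum>j<4. ?v j * max (?w j * vec_nth x (coord 0) + ?b j) 0)"
      by (simp add: crossing_def kink_def eval_nat_numeral algebra_simps)
  qed (use F in auto)
qed

text \<open>The requirements on a difference of densities, with constants that do not change with
  the sample size. Mean zero normalises the densities, and the bound by the inverse volume keeps
  them away from 0.\<close>

locale contrast =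
  fixes X :: "(real ^ 'd::finite) set" and c B F :: real and f :: "real ^ 'd \<Rightarrow> real"
  assumes X: "X \<in> sets borel" "bounded X" "0 < emeasure lborel X"
    and f_measurable: "f \<in> borel_measurable borel"
    and f_bound: "x \<in> X \<Longrightarrow> \<bar>f x\<bar> \<le> 1 / measure lborel X"
    and f_mean: "(\<integral>x. f x \<partial>leb_on X) = 0"
    and f_net: "f \<in> DNN X 1 4 (4 * CARD('d) + 9) B F"
    and f_margin: "0 \<le> t \<Longrightarrow> measure (leb_on X) {x \<in> X. \<bar>f x\<bar> \<le> t} \<le> c * t"
text \<open>The crossings are scaled by one factor \<epsilon>, independent of \<delta>. Scaling
  keeps the signs and the zero mean; squared distances, margin and separation change by fixed
  factors.\<close>

lemma contrast_pair:
  fixes X :: "(real ^ 'd::finite) set"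
  assumes X: "X \<in> sets borel" "bounded X" "0 < emeasure lborel X"
  obtains B F c \<kappa> C \<delta>0 where "0 < c" "0 < \<kappa>" "0 < C" "0 < \<delta>0"
    "\<forall>\<delta>. 0 < \<delta> \<and> \<delta> \<le> \<delta>0 \<longrightarrow> (\<exists>f g A. contrast X c B F f \<and> contrast X c B F g \<and>
        (\<integral>x. (f x - g x)\<^sup>2 \<partial>leb_on X) \<le> C * \<delta> ^ 3 \<and>
        A \<in> sets (leb_on X) \<and> \<kappa> * \<delta> \<le> measure (leb_on X) A \<and>
        (\<forall>x\<in>A. \<kappa> * \<delta> \<le> f x \<and> g x \<le> - (\<kappa> * \<delta>)))"
proof -
  let ?i = "coord 0 :: 'd" and ?M = "leb_on X"
  obtain R K where "slab_measure ?M (\<lambda>x. vec_nth x ?i) R K"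
    using slab_measure_leb_on[OF X] .
  then interpret slab_measure ?M "\<lambda>x. vec_nth x ?i" R K .
  obtain \<sigma> \<Lambda> \<kappa> C \<delta>0 where pos: "0 < \<sigma>" "\<sigma> \<le> 1 / 2" "0 < \<Lambda>" "0 < \<kappa>" "0 < C" "0 < \<delta>0" "\<delta>0 \<le> 1"
    and cross: "\<forall>\<delta>. 0 < \<delta> \<and> \<delta> \<le> \<delta>0 \<longrightarrow> (\<exists>a \<mu>1 \<mu>2. \<bar>a\<bar> \<le> R + 2 \<and>
       \<kappa> * \<delta> \<le> measure ?M {x \<in> space ?M. \<bar>vec_nth x ?i - a\<bar> \<le> \<delta> / 8} \<and>
       \<sigma> \<le> \<mu>1 \<and> \<mu>1 \<le> \<Lambda> \<and> \<sigma> \<le> \<mu>2 \<and> \<mu>2 \<le> \<Lambda> \<and>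
       (\<integral>x. crossing 1 \<delta> \<mu>1 (vec_nth x ?i - a) \<partial>?M) = 0 \<and> (\<integral>x. crossing (-1) \<delta> \<mu>2 (vec_nth x ?i - a) \<partial>?M) = 0 \<and>
       (\<integral>x. (crossing 1 \<delta> \<mu>1 (vec_nth x ?i - a) - crossing (-1) \<delta> \<mu>2 (vec_nth x ?i - a))\<^sup>2 \<partial>?M) \<le> C * \<delta> ^ 3)"
    by (rule two_crossings)
  define V where "V = measure lborel X"
  have V: "0 < V" using mass_pos X(1) by (simp add: V_def space_leb_on measure_restrict_space)
  define b where "b = 2 * R + 2"
  \<comment> \<open>By \<open>crossing_bound\<close> with \<delta> at most 1, this scaling keeps the
    absolute values within 1/V.\<close>
  define \<epsilon> where "\<epsilon> = 1 / (V * (1 + b + \<Lambda> * b))"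
  have b: "0 < b" using R_nonneg by (simp add: b_def)
  have bb: "0 < 1 + b + \<Lambda> * b" using b pos by (simp add: add_pos_pos)
  have \<epsilon>: "0 < \<epsilon>" using bb V by (simp add: \<epsilon>_def)
  define c where "c = K / (\<epsilon> * \<sigma>)"
  have c: "0 < c" using K_pos \<epsilon> pos by (simp add: c_def)
  define B where "B = (R + 2) + 2 + \<epsilon> * (2 + \<Lambda>)"
  have contr: "contrast X c B (1 / V) (\<lambda>x. \<epsilon> * crossing s \<delta> \<mu> (vec_nth x ?i - a))"
    if \<delta>: "0 < \<delta>" "\<delta> \<le> 1" and s: "s = 1 \<or> s = -1" and \<mu>: "\<sigma> \<le> \<mu>" "\<mu> \<le> \<Lambda>" and a: "\<bar>a\<bar> \<le> R + 2"
      and mean: "(\<integral>x. crossing s \<delta> \<mu> (vec_nth x ?i - a) \<partial>?M) = 0" for \<delta> s \<mu> a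
  proof -
    have bound: "\<bar>\<epsilon> * crossing s \<delta> \<mu> (vec_nth x ?i - a)\<bar> \<le> 1 / V" if "x \<in> X" for x
    proof -
      have "\<bar>vec_nth x ?i - a\<bar> \<le> b"
        using \<tau>_bounded[of x] that a by (simp add: space_leb_on b_def)
      then have "\<bar>crossing s \<delta> \<mu> (vec_nth x ?i - a)\<bar> \<le> \<delta> + b + \<Lambda> * b"
        using \<delta> s \<mu> pos by (intro crossing_bound) auto
      then have "\<epsilon> * \<bar>crossing s \<delta> \<mu> (vec_nth x ?i - a)\<bar> \<le> \<epsilon> * (1 + b + \<Lambda> * b)"
        using \<epsilon> \<delta> by (intro mult_left_mono) auto
      also have "\<dots> = 1 / V" using bb by (simp add: \<epsilon>_def)
      finally show ?thesis using \<epsilon> by (simp add: abs_mult)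
    qed
    show ?thesis
    proof
      show "X \<in> sets borel" "bounded X" "0 < emeasure lborel X" by fact+
      show "(\<lambda>x. \<epsilon> * crossing s \<delta> \<mu> (vec_nth x ?i - a)) \<in> borel_measurable borel"
        unfolding crossing_def kink_def by measurable
      show "(\<integral>x. \<epsilon> * crossing s \<delta> \<mu> (vec_nth x ?i - a) \<partial>?M) = 0"
        using mean by simp
      show "(\<lambda>x. \<epsilon> * crossing s \<delta> \<mu> (vec_nth x ?i - a)) \<in> DNN X 1 4 (4 * CARD('d) + 9) B (1 / V)"
        unfolding B_def using \<delta> s \<mu> pos a \<epsilon> bound by (intro crossing_in_DNN) auto
      fix t :: real assume t: "0 \<le> t"
      have "measure ?M {x \<in> X. \<bar>\<epsilon> * crossing s \<delta> \<mu> (vec_nth x ?i - a)\<bar> \<le> t}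
          \<le> measure ?M {x \<in> space ?M. \<bar>vec_nth x ?i - (a - s * \<delta> / 3)\<bar> \<le> t / (\<epsilon> * \<sigma>)}"
      proof (rule finite_measure_mono)
        show "{x \<in> X. \<bar>\<epsilon> * crossing s \<delta> \<mu> (vec_nth x ?i - a)\<bar> \<le> t}
          \<subseteq> {x \<in> space ?M. \<bar>vec_nth x ?i - (a - s * \<delta> / 3)\<bar> \<le> t / (\<epsilon> * \<sigma>)}"
        proof
          fix x assume x: "x \<in> {x \<in> X. \<bar>\<epsilon> * crossing s \<delta> \<mu> (vec_nth x ?i - a)\<bar> \<le> t}"
          have "\<sigma> * \<bar>(vec_nth x ?i - a) + s * \<delta> / 3\<bar> \<le> \<bar>crossing s \<delta> \<mu> (vec_nth x ?i - a)\<bar>"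
            using \<delta> s \<mu> pos by (intro crossing_margin) auto
          then have "\<epsilon> * (\<sigma> * \<bar>(vec_nth x ?i - a) + s * \<delta> / 3\<bar>) \<le> \<epsilon> * \<bar>crossing s \<delta> \<mu> (vec_nth x ?i - a)\<bar>"
            using \<epsilon> by (intro mult_left_mono) auto
          also have "\<dots> \<le> t" using x \<epsilon> by (simp add: abs_mult)
          finally have "\<bar>vec_nth x ?i - (a - s * \<delta> / 3)\<bar> \<le> t / (\<epsilon> * \<sigma>)"
            using \<epsilon> pos by (simp add: pos_le_divide_eq mult_ac algebra_simps)
          then show "x \<in> {x \<in> space ?M. \<bar>vec_nth x ?i - (a - s * \<delta> / 3)\<bar> \<le> t / (\<epsilon> * \<sigma>)}"
            using x by (simp add: space_leb_on)
        qed
      qed measurable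
      also have "\<dots> \<le> K * (t / (\<epsilon> * \<sigma>))" using t \<epsilon> pos by (intro slab) auto
      finally show "measure ?M {x \<in> X. \<bar>\<epsilon> * crossing s \<delta> \<mu> (vec_nth x ?i - a)\<bar> \<le> t} \<le> c * t"
        by (simp add: c_def)
    qed (use bound V_def in auto)
  qed
  \<comment> \<open>One constant for two purposes: the mass of the middle slab, and the height
    \<delta>/4 from \<open>crossing_sign\<close> after scaling.\<close>
  define \<kappa>' where "\<kappa>' = min \<kappa> (\<epsilon> / 4)"
  show ?thesis
  proof (rule that[of c \<kappa>' "\<epsilon>\<^sup>2 * C" \<delta>0 B "1 / V"])
    show "0 < c" "0 < \<kappa>'" "0 < \<epsilon>\<^sup>2 * C" "0 < \<delta>0"
      using c pos \<epsilon> by (auto simp: \<kappa>'_def)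
    show "\<forall>\<delta>. 0 < \<delta> \<and> \<delta> \<le> \<delta>0 \<longrightarrow> (\<exists>f g A. contrast X c B (1 / V) f \<and> contrast X c B (1 / V) g \<and>
        (\<integral>x. (f x - g x)\<^sup>2 \<partial>leb_on X) \<le> (\<epsilon>\<^sup>2 * C) * \<delta> ^ 3 \<and>
        A \<in> sets (leb_on X) \<and> \<kappa>' * \<delta> \<le> measure (leb_on X) A \<and>
        (\<forall>x\<in>A. \<kappa>' * \<delta> \<le> f x \<and> g x \<le> - (\<kappa>' * \<delta>)))"
    proof (intro allI impI, elim conjE)
      fix \<delta> assume \<delta>: "0 < \<delta>" "\<delta> \<le> \<delta>0"
      obtain a \<mu>1 \<mu>2 where a: "\<bar>a\<bar> \<le> R + 2"
        and mass: "\<kappa> * \<delta> \<le> measure ?M {x \<in> space ?M. \<bar>vec_nth x ?i - a\<bar> \<le> \<delta> / 8}"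
        and \<mu>: "\<sigma> \<le> \<mu>1" "\<mu>1 \<le> \<Lambda>" "\<sigma> \<le> \<mu>2" "\<mu>2 \<le> \<Lambda>"
        and mean: "(\<integral>x. crossing 1 \<delta> \<mu>1 (vec_nth x ?i - a) \<partial>?M) = 0"
          "(\<integral>x. crossing (-1) \<delta> \<mu>2 (vec_nth x ?i - a) \<partial>?M) = 0"
        and sq: "(\<integral>x. (crossing 1 \<delta> \<mu>1 (vec_nth x ?i - a) - crossing (-1) \<delta> \<mu>2 (vec_nth x ?i - a))\<^sup>2 \<partial>?M) \<le> C * \<delta> ^ 3"
        using cross[rule_format, of \<delta>] \<delta> by blast
      let ?f = "\<lambda>x. \<epsilon> * crossing 1 \<delta> \<mu>1 (vec_nth x ?i - a)" and ?g = "\<lambda>x. \<epsilon> * crossing (-1) \<delta> \<mu>2 (vec_nth x ?i - a)"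
      let ?A = "{x \<in> space ?M. \<bar>vec_nth x ?i - a\<bar> \<le> \<delta> / 8}"
      have "contrast X c B (1 / V) ?f" "contrast X c B (1 / V) ?g"
        using \<delta> pos \<mu> a mean by (auto intro!: contr)
      moreover have "(\<integral>x. (?f x - ?g x)\<^sup>2 \<partial>leb_on X) \<le> (\<epsilon>\<^sup>2 * C) * \<delta> ^ 3"
      proof -
        have "(\<integral>x. (?f x - ?g x)\<^sup>2 \<partial>leb_on X) = \<epsilon>\<^sup>2 * (\<integral>x. (crossing 1 \<delta> \<mu>1 (vec_nth x ?i - a)
            - crossing (-1) \<delta> \<mu>2 (vec_nth x ?i - a))\<^sup>2 \<partial>?M)"
          by (simp add: right_diff_distrib[symmetric] power_mult_distrib)
        then show ?thesis using sq \<epsilon> by (simp add: mult.assoc mult_left_mono)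
      qed
      moreover have "?A \<in> sets ?M" by measurable
      moreover have "\<kappa>' * \<delta> \<le> measure ?M ?A"
        using mass \<delta> by (intro order_trans[OF mult_right_mono mass]) (auto simp: \<kappa>'_def)
      moreover have "\<forall>x\<in>?A. \<kappa>' * \<delta> \<le> ?f x \<and> ?g x \<le> - (\<kappa>' * \<delta>)"
      proof
        fix x assume "x \<in> ?A"
        then have "\<bar>vec_nth x ?i - a\<bar> \<le> \<delta> / 8" by blast
        then have cs: "\<delta> / 4 \<le> crossing 1 \<delta> \<mu>1 (vec_nth x ?i - a)" "\<delta> / 4 \<le> - crossing (-1) \<delta> \<mu>2 (vec_nth x ?i - a)"
          using crossing_sign(1)[OF \<delta>(1), of "vec_nth x ?i - a" \<mu>1]
            crossing_sign(2)[OF \<delta>(1), of "vec_nth x ?i - a" \<mu>2] by auto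
        have "\<epsilon> * (\<delta> / 4) \<le> ?f x" "\<epsilon> * (\<delta> / 4) \<le> \<epsilon> * (- crossing (-1) \<delta> \<mu>2 (vec_nth x ?i - a))"
          by (rule mult_left_mono[OF cs(1) less_imp_le[OF \<epsilon>]] mult_left_mono[OF cs(2) less_imp_le[OF \<epsilon>]])+
        moreover have "\<kappa>' * \<delta> \<le> (\<epsilon> / 4) * \<delta>"
          using \<delta> by (intro mult_right_mono) (auto simp: \<kappa>'_def)
        ultimately show "\<kappa>' * \<delta> \<le> ?f x \<and> ?g x \<le> - (\<kappa>' * \<delta>)" by simp
      qed
      ultimately show "\<exists>f g A. contrast X c B (1 / V) f \<and> contrast X c B (1 / V) g \<and>
        (\<integral>x. (f x - g x)\<^sup>2 \<partial>leb_on X) \<le> (\<epsilon>\<^sup>2 * C) * \<delta> ^ 3 \<and>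
        A \<in> sets (leb_on X) \<and> \<kappa>' * \<delta> \<le> measure (leb_on X) A \<and>
        (\<forall>x\<in>A. \<kappa>' * \<delta> \<le> f x \<and> g x \<le> - (\<kappa>' * \<delta>))"
        by blast
    qed
  qed
qed

text \<open>The densities with constant sum and difference \<open>f\<close> are \<open>tilt X f\<close> and \<open>tilt X (- f)\<close>.\<close>
definition tilt :: "(real ^ 'd::finite) set \<Rightarrow> (real ^ 'd \<Rightarrow> real) \<Rightarrow> real ^ 'd \<Rightarrow> real" where
  "tilt X f x = 1 / measure lborel X + f x / 2"

section \<open>Risks under the pair of densities with contrast \<open>f\<close>\<close>

context contrast
begin

abbreviation V :: real where "V \<equiv> measure lborel X"
abbreviation p :: "real ^ 'd \<Rightarrow> real" where "p \<equiv> tilt X f"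
abbreviation q :: "real ^ 'd \<Rightarrow> real" where "q \<equiv> tilt X (\<lambda>x. - f x)"

lemma V_pos: "0 < V"
  using X emeasure_bounded_finite[OF X(2)] by (simp add: measure_def enn2real_positive_iff)

lemma f_measurable_leb_on [measurable]: "f \<in> borel_measurable (leb_on X)"
  using f_measurable by (intro measurable_restrict_space1) simp

lemma p_minus_q: "p x - q x = f x"
  by (simp add: tilt_def)

text \<open>Each density deviates from the uniform one by at most half of it. This bounds the
  likelihood ratios and the denominators of the chi-square distance.\<close>

lemma tilt_bounds:
  assumes "x \<in> X"
  shows "1 / (2 * V) \<le> p x" "p x \<le> 3 / (2 * V)" "1 / (2 * V) \<le> q x" "q x \<le> 3 / (2 * V)"
proof -
  have "1 / (2 * V) = (1 / V) / 2" "3 / (2 * V) = 3 * (1 / V) / 2" by simp_all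
  then show "1 / (2 * V) \<le> p x" "p x \<le> 3 / (2 * V)" "1 / (2 * V) \<le> q x" "q x \<le> 3 / (2 * V)"
    using f_bound[OF assms] unfolding tilt_def by linarith+
qed

lemma integrable_leb_on_bounded:
  fixes g :: "real ^ 'd \<Rightarrow> real"
  assumes "g \<in> borel_measurable (leb_on X)" "\<And>x. x \<in> X \<Longrightarrow> \<bar>g x\<bar> \<le> b"
  shows "integrable (leb_on X) g"
  using assms
  by (intro finite_measure.integrable_const_bound[OF finite_measure_leb_on[OF X(1,2)], where B = b])
    (auto simp: space_leb_on)

lemma integral_const_leb_on: "(\<integral>x. b \<partial>leb_on X) = b * V" for b :: real
  using X(1) by (simp add: space_leb_on measure_restrict_space)

lemma bounded_density_tilt: "bounded_density X p" "bounded_density X q"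
proof -
  have "bounded_density X (tilt X g)" if g: "g = f \<or> g = (\<lambda>x. - f x)" for g
  proof -
    have [measurable]: "g \<in> borel_measurable (leb_on X)" using g by auto
    have m: "tilt X g \<in> borel_measurable (leb_on X)" unfolding tilt_def[abs_def] by measurable
    have b: "1 / (2 * V) \<le> tilt X g x \<and> tilt X g x \<le> 3 / (2 * V)" if "x \<in> X" for x
      using tilt_bounds[OF that] g by auto
    have b0: "0 \<le> tilt X g x" if "x \<in> X" for x
      using b[OF that] V_pos by (auto intro: order_trans[rotated])
    have i: "integrable (leb_on X) f" using f_bound by (intro integrable_leb_on_bounded) auto
    then have ig: "integrable (leb_on X) g" using g by auto
    have "(\<integral>x. g x \<partial>leb_on X) = 0" using g f_mean by auto
    moreover have "(\<integral>x. tilt X g x \<partial>leb_on X) = (\<integral>x. 1 / V \<partial>leb_on X) + (\<integral>x. g x / 2 \<partial>leb_on X)"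
      unfolding tilt_def
    proof (rule Bochner_Integration.integral_add)
      show "integrable (leb_on X) (\<lambda>x. 1 / V)"
        by (rule finite_measure.integrable_const[OF finite_measure_leb_on[OF X(1,2)]])
    qed (use ig in simp)
    ultimately have "(\<integral>x. tilt X g x \<partial>leb_on X) = 1"
      unfolding integral_const_leb_on using V_pos by simp
    moreover have "integrable (leb_on X) (tilt X g)"
      using m b b0 by (intro integrable_leb_on_bounded[where b = "3 / (2 * V)"]) auto
    ultimately have "(\<integral>\<^sup>+x. ennreal (tilt X g x) \<partial>leb_on X) = 1"
      using b0 by (subst nn_integral_eq_integral) (auto simp: space_leb_on)
    then show ?thesis
      unfolding bounded_density_def measurable_leb_on[OF X(1)] using m b b0 by blast
  qed
  then show "bounded_density X p" "bounded_density X q" by auto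
qed

text \<open>Enlarging any of these bounds enlarges the class, and \<open>f_margin\<close> holds at
  every level \<open>t\<close>, hence up to any \<open>T\<close>. The supports have compact closure
  because \<open>X\<close> is bounded.\<close>

lemma tilt_in_teacher_class:
  assumes "1 \<le> L" "4 \<le> N" "4 * CARD('d) + 9 \<le> S" "B \<le> B'" "F \<le> F'" "c \<le> c'"
  shows "(p, q) \<in> teacher_class X L N S B' F' c' T"
proof -
  have "compact (closure {x \<in> X. P x})" for P
    using X(2) by (auto intro: bounded_subset)
  moreover have "f \<in> DNN X L N S B' F'"
    using assms by (intro DNN_mono[OF f_net])
  moreover have "emeasure lborel {x \<in> X. \<bar>f x\<bar> \<le> t} \<le> ennreal (c' * t)" if t: "0 \<le> t" for t
  proof -
    have "emeasure lborel {x \<in> X. \<bar>f x\<bar> \<le> t} = emeasure (leb_on X) {x \<in> X. \<bar>f x\<bar> \<le> t}"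
      using X(1) by (subst emeasure_restrict_space) auto
    also have "\<dots> = ennreal (measure (leb_on X) {x \<in> X. \<bar>f x\<bar> \<le> t})"
      by (intro finite_measure.emeasure_eq_measure finite_measure_leb_on X)
    also have "\<dots> \<le> ennreal (c' * t)"
      using f_margin[OF t] mult_right_mono[OF assms(6) t] by (intro ennreal_leI) simp
    finally show ?thesis .
  qed
  ultimately show ?thesis
    unfolding teacher_class_def using bounded_density_tilt p_minus_q by auto
qed

definition loss :: "(real ^ 'd \<Rightarrow> real) \<Rightarrow> real ^ 'd \<Rightarrow> real" where
  "loss h x = 1 / 2 * (if (0 \<le> h x) = (0 \<le> f x) then 0 else \<bar>f x\<bar>)"

lemma loss_bounds: "0 \<le> loss h x" "x \<in> X \<Longrightarrow> loss h x \<le> 1 / V"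
  using f_bound[of x] V_pos by (auto simp: loss_def intro: order_trans[rotated])

lemma integrable_loss:
  assumes [measurable]: "h \<in> borel_measurable (leb_on X)"
  shows "integrable (leb_on X) (loss h)"
proof (rule integrable_leb_on_bounded)
  show "loss h \<in> borel_measurable (leb_on X)" unfolding loss_def[abs_def] by measurable
  show "\<bar>loss h x\<bar> \<le> 1 / V" if "x \<in> X" for x
    using loss_bounds(1)[of h x] loss_bounds(2)[OF that, of h] by simp
qed

lemma excess_risk_tilt:
  assumes "h \<in> borel_measurable (leb_on X)"
  shows "excess_risk X p q h (\<lambda>x. p x - q x) = (\<integral>x. loss h x \<partial>leb_on X)"
  unfolding loss_def using excess_risk_eq[OF X(1,2) bounded_density_tilt assms] unfolding p_minus_q .

lemma integral_le_excess_risk: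
  assumes h: "h \<in> borel_measurable (leb_on X)" and w_m: "w \<in> borel_measurable (leb_on X)"
    and w: "\<And>x. x \<in> X \<Longrightarrow> 0 \<le> w x" "\<And>x. x \<in> X \<Longrightarrow> w x \<le> loss h x"
  shows "(\<integral>x. w x \<partial>leb_on X) \<le> excess_risk X p q h (\<lambda>x. p x - q x)"
  unfolding excess_risk_tilt[OF h]
proof (rule integral_mono)
  have "\<bar>w x\<bar> \<le> 1 / V" if "x \<in> X" for x
    using w[OF that] loss_bounds(2)[OF that, of h] by linarith
  then show "integrable (leb_on X) w" by (rule integrable_leb_on_bounded[OF w_m])
qed (use w integrable_loss[OF h] in \<open>auto simp: space_leb_on\<close>)

end

lemma sets_sample_distr: "sets (sample_distr X p q n) = sets (Pi\<^sub>M {..<n} (\<lambda>_. obs_space X))"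
  unfolding sample_distr_def by (intro sets_PiM_cong) (auto simp: sets_obs_distr)

lemma estimator_measurable:
  assumes X: "X \<in> sets borel" and h: "h \<in> estimators X n G"
  shows "(\<lambda>(D, x). h D x) \<in> borel_measurable (Pi\<^sub>M {..<n} (\<lambda>_. obs_space X) \<Otimes>\<^sub>M leb_on X)"
    and "D \<in> space (Pi\<^sub>M {..<n} (\<lambda>_. obs_space X)) \<Longrightarrow> h D \<in> borel_measurable (leb_on X)"
proof -
  have "sets (Pi\<^sub>M {..<n} (\<lambda>_. obs_space X) \<Otimes>\<^sub>M restrict_space borel X)
      = sets (Pi\<^sub>M {..<n} (\<lambda>_. obs_space X) \<Otimes>\<^sub>M leb_on X)"
    by (intro sets_pair_measure_cong sets_restrict_leb X refl)
  with h show m: "(\<lambda>(D, x). h D x) \<in> borel_measurable (Pi\<^sub>M {..<n} (\<lambda>_. obs_space X) \<Otimes>\<^sub>M leb_on X)"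
    by (simp add: estimators_def cong: measurable_cong_sets)
  show "h D \<in> borel_measurable (leb_on X)" if "D \<in> space (Pi\<^sub>M {..<n} (\<lambda>_. obs_space X))"
    using measurable_compose[OF measurable_Pair1'[OF that] m] by simp
qed

context contrast
begin

text \<open>A Bochner integral defaults to 0 without integrability, so the excess risk has to be
  integrable in the sample before it can be bounded below. It is measurable by joint measurability
  of the estimator, and at most 1 because the loss is at most 1/V.\<close>

lemma expected_excess_risk_ge:
  assumes h: "h \<in> estimators X n G"
    and w: "w \<in> borel_measurable (Pi\<^sub>M {..<n} (\<lambda>_. obs_space X))"
      "\<And>D. D \<in> space (Pi\<^sub>M {..<n} (\<lambda>_. obs_space X)) \<Longrightarrow>
        0 \<le> w D \<and> w D \<le> excess_risk X p q (h D) (\<lambda>x. p x - q x)"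
  shows "(\<integral>D. w D \<partial>sample_distr X p q n) \<le> (\<integral>D. excess_risk X p q (h D) (\<lambda>x. p x - q x) \<partial>sample_distr X p q n)"
proof -
  let ?S = "Pi\<^sub>M {..<n} (\<lambda>_. obs_space X)" and ?P = "sample_distr X p q n"
  note [measurable_cong] = sets_sample_distr[of X p q n]
  note [measurable] = estimator_measurable(1)[OF X(1) h]
  have sp: "space ?P = space ?S" using sets_eq_imp_space_eq[OF sets_sample_distr] .
  interpret P: prob_space ?P
    unfolding sample_distr_def by (intro prob_space_PiM prob_space_obs_distr X bounded_density_tilt)
  interpret M: finite_measure "leb_on X" by (rule finite_measure_leb_on[OF X(1,2)])
  let ?e = "\<lambda>D. \<integral>x. loss (h D) x \<partial>leb_on X"
  have e: "excess_risk X p q (h D) (\<lambda>x. p x - q x) = ?e D" if "D \<in> space ?S" for D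
    using estimator_measurable(2)[OF X(1) h that] by (rule excess_risk_tilt)
  have em: "?e \<in> borel_measurable ?S" unfolding loss_def by measurable
  have e_bound: "\<bar>?e D\<bar> \<le> 1" if D: "D \<in> space ?S" for D
  proof -
    have "?e D \<le> (\<integral>x. 1 / V \<partial>leb_on X)"
      by (rule integral_mono[OF integrable_loss[OF estimator_measurable(2)[OF X(1) h D]]])
        (use loss_bounds(2) in \<open>auto simp: space_leb_on\<close>)
    also have "\<dots> = 1" unfolding integral_const_leb_on using V_pos by simp
    moreover have "0 \<le> ?e D" by (rule Bochner_Integration.integral_nonneg) (rule loss_bounds)
    ultimately show ?thesis by simp
  qed
  have ei: "integrable ?P ?e"
    using e_bound em by (intro P.integrable_const_bound[where B = 1]) (auto simp: sp)
  have "(\<integral>D. w D \<partial>?P) \<le> (\<integral>D. ?e D \<partial>?P)"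
  proof (rule integral_mono[OF _ ei])
    show "integrable ?P w"
    proof (rule Bochner_Integration.integrable_bound[OF ei])
      show "AE D in ?P. norm (w D) \<le> norm (?e D)"
      proof (rule AE_I2)
        fix D assume "D \<in> space ?P"
        then show "norm (w D) \<le> norm (?e D)" using w(2)[of D] e[of D] by (simp add: sp)
      qed
    qed (use w in simp)
  qed (use w e in \<open>auto simp: sp\<close>)
  also have "(\<integral>D. ?e D \<partial>?P) = (\<integral>D. excess_risk X p q (h D) (\<lambda>x. p x - q x) \<partial>?P)"
    by (intro Bochner_Integration.integral_cong refl) (simp add: sp e)
  finally show ?thesis .
qed

end

section \<open>The lower bound\<close>

text \<open>The ratio of the joint densities, where the label probabilities 1/2 cancel. The absolute
  value changes nothing on \<open>X\<close>; it makes \<open>l\<close> nonnegative everywhere, as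
  \<open>two_point_test\<close> demands, also off \<open>X\<close> where the functions are
  arbitrary.\<close>

lemma obs_distr_change:
  fixes p q p' q' :: "real ^ 'd::finite \<Rightarrow> real"
  assumes X: "X \<in> sets borel" and pq: "bounded_density X p" "bounded_density X q"
    and pq': "bounded_density X p'" "bounded_density X q'"
    and pos: "\<And>x. x \<in> X \<Longrightarrow> 0 < p' x \<and> 0 < q' x"
  defines "l \<equiv> (\<lambda>(x, y::int). \<bar>(if y = 1 then p x else q x) / (if y = 1 then p' x else q' x)\<bar>)"
  shows "l \<in> borel_measurable (obs_space X)" "obs_distr X p q = density (obs_distr X p' q') l"
proof -
  note [measurable] = bounded_densityD(1)[OF X pq(1)] bounded_densityD(1)[OF X pq(2)]
    bounded_densityD(1)[OF X pq'(1)] bounded_densityD(1)[OF X pq'(2)]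
  show l[measurable]: "l \<in> borel_measurable (obs_space X)"
    unfolding l_def obs_space_def by measurable
  have r: "(\<lambda>(x, y). 1 / 2 * (if y = 1 then p x else q x)) \<in> borel_measurable (obs_space X)"
    "(\<lambda>(x, y). 1 / 2 * (if y = 1 then p' x else q' x)) \<in> borel_measurable (obs_space X)"
    by (rule obs_space_label_measurable; measurable)+
  have "density (obs_distr X p' q') l
      = density (obs_space X) (\<lambda>z. ennreal (case z of (x, y) \<Rightarrow> 1 / 2 * (if y = 1 then p' x else q' x)) * ennreal (l z))"
    unfolding obs_distr_def case_prod_unfold using r
    by (intro density_density_eq) (auto simp: case_prod_unfold)
  also have "\<dots> = obs_distr X p q"
    unfolding obs_distr_def
  proof (rule density_cong)
    show "AE z in obs_space X. ennreal (case z of (x, y) \<Rightarrow> 1 / 2 * (if y = 1 then p' x else q' x)) * ennreal (l z)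
        = (case z of (x, y) \<Rightarrow> ennreal (1 / 2 * (if y = 1 then p x else q x)))"
    proof (rule AE_I2)
      fix z assume "z \<in> space (obs_space X)"
      then obtain x y where z: "z = (x, y)" "x \<in> X"
        by (auto simp: obs_space_def space_pair_measure space_leb_on)
      have "0 \<le> p x" "0 \<le> q x" "0 < p' x" "0 < q' x"
        using pos[OF z(2)] bounded_densityD(2)[OF X pq(1) z(2)] bounded_densityD(2)[OF X pq(2) z(2)] by auto
      then show "ennreal (case z of (x, y) \<Rightarrow> 1 / 2 * (if y = 1 then p' x else q' x)) * ennreal (l z)
        = (case z of (x, y) \<Rightarrow> ennreal (1 / 2 * (if y = 1 then p x else q x)))"
        by (auto simp: z l_def ennreal_mult[symmetric])
    qed
  qed (use r in \<open>auto simp: case_prod_unfold\<close>)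
  finally show "obs_distr X p q = density (obs_distr X p' q') l" by simp
qed

text \<open>Expansion of u^2/v around \<open>v\<close>. The linear terms cancel when both labels are
  added, since the two density differences are opposite; the quadratic term is the chi-square
  contribution.\<close>

lemma ratio_sq_le:
  fixes u v b :: real
  assumes "1 / (2 * b) \<le> v" "0 < b"
  shows "v * \<bar>u / v\<bar>\<^sup>2 \<le> v + 2 * (u - v) + 2 * b * (u - v)\<^sup>2"
proof -
  have v: "0 < v" using assms by (auto intro: order_less_le_trans[rotated])
  have "v * \<bar>u / v\<bar>\<^sup>2 = v + 2 * (u - v) + (u - v)\<^sup>2 / v"
    using v by (simp add: field_simps power2_eq_square)
  moreover have "(u - v)\<^sup>2 / v \<le> (u - v)\<^sup>2 / (1 / (2 * b))"
    using assms v by (intro divide_left_mono) auto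
  ultimately show ?thesis by (simp add: mult_ac)
qed

text \<open>Le Cam's two-point method: a classifier that is right about the sign of \<open>f\<close> on part of \<open>A\<close> is
  wrong there about the sign of \<open>g\<close>, and the sample cannot tell the two hypotheses apart.\<close>
lemma two_point_risk:
  fixes X :: "(real ^ 'd::finite) set"
  assumes "contrast X c B F f" "contrast X c B F g"
    and Q: "(\<integral>x. (f x - g x)\<^sup>2 \<partial>leb_on X) \<le> Q" "real n * (measure lborel X / 2 * Q) \<le> 1 / 5"
    and A: "A \<in> sets (leb_on X)" "0 < measure (leb_on X) A"
    and sep: "0 < \<eta>" "\<And>x. x \<in> A \<Longrightarrow> \<eta> \<le> f x \<and> g x \<le> - \<eta>"
    and h: "h \<in> estimators X n G"
  shows "\<eta> * measure (leb_on X) A / 4 \<le>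
    (\<integral>D. excess_risk X (tilt X f) (tilt X (\<lambda>x. - f x)) (h D) (\<lambda>x. tilt X f x - tilt X (\<lambda>x. - f x) x)
      \<partial>sample_distr X (tilt X f) (tilt X (\<lambda>x. - f x)) n) +
    (\<integral>D. excess_risk X (tilt X g) (tilt X (\<lambda>x. - g x)) (h D) (\<lambda>x. tilt X g x - tilt X (\<lambda>x. - g x) x)
      \<partial>sample_distr X (tilt X g) (tilt X (\<lambda>x. - g x)) n)"
proof -
  interpret f: contrast X c B F f by fact
  interpret g: contrast X c B F g by fact
  note X = f.X(1,2)
  let ?M = "leb_on X" and ?V = "measure lborel X" and ?S = "Pi\<^sub>M {..<n} (\<lambda>_. obs_space X)"
  interpret M: finite_measure ?M by (rule finite_measure_leb_on[OF X])
  let ?P = "obs_distr X g.p g.q"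
  define l :: "(real ^ 'd) \<times> int \<Rightarrow> real" where
    "l = (\<lambda>(x, y). \<bar>(if y = 1 then f.p x else f.q x) / (if y = 1 then g.p x else g.q x)\<bar>)"
  have half: "0 < 1 / (2 * ?V)" using f.V_pos by simp
  have pos: "0 < g.p x \<and> 0 < g.q x \<and> 0 < f.p x \<and> 0 < f.q x" if "x \<in> X" for x
    using f.tilt_bounds[OF that] g.tilt_bounds[OF that] half by linarith
  have l: "l \<in> borel_measurable (obs_space X)" "obs_distr X f.p f.q = density ?P l"
    unfolding l_def using obs_distr_change[OF X(1) f.bounded_density_tilt g.bounded_density_tilt] pos by auto
  note [measurable] = l(1) estimator_measurable(1)[OF X(1) h] A(1)
  have l3: "\<bar>l z\<bar> \<le> 3" if z: "z \<in> space (obs_space X)" for z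
  proof -
    obtain x y where z: "z = (x, y)" "x \<in> X"
      using z by (auto simp: obs_space_def space_pair_measure space_leb_on)
    have "a / b \<le> 3 / (2 * ?V) / (1 / (2 * ?V))"
      if "0 < a" "a \<le> 3 / (2 * ?V)" "1 / (2 * ?V) \<le> b" for a b
      using that half by (intro frac_le) auto
    then have le3: "a / b \<le> 3" if "0 < a" "a \<le> 3 / (2 * ?V)" "1 / (2 * ?V) \<le> b" for a b
      using that f.V_pos by simp
    show ?thesis
      using pos[OF z(2)] f.tilt_bounds[OF z(2)] g.tilt_bounds[OF z(2)] by (auto simp: z l_def intro!: le3)
  qed
  have l_int: "integrable ?P l" and l_val: "(\<integral>z. l z \<partial>?P) = 1"
  proof -
    show "integrable ?P l"
      by (rule integral_obs_distr(1)[OF X g.bounded_density_tilt l(1) l3])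
    have "(\<integral>z. l z \<partial>?P) = (\<integral>x. 1 / 2 * (g.p x * l (x, 1) + g.q x * l (x, -1)) \<partial>?M)"
      by (rule integral_obs_distr(2)[OF X g.bounded_density_tilt l(1) l3])
    also have "\<dots> = (\<integral>x. 1 / ?V \<partial>?M)"
    proof (rule Bochner_Integration.integral_cong[OF refl])
      fix x assume "x \<in> space ?M"
      then have "g.p x * l (x, 1) = f.p x" "g.q x * l (x, -1) = f.q x"
        using pos[of x] by (auto simp: space_leb_on l_def abs_mult abs_divide)
      then show "1 / 2 * (g.p x * l (x, 1) + g.q x * l (x, -1)) = 1 / ?V"
        by (simp add: tilt_def)
    qed
    also have "\<dots> = 1" unfolding f.integral_const_leb_on using f.V_pos by simp
    finally show "(\<integral>z. l z \<partial>?P) = 1" .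
  qed
  have l9: "\<bar>(l z)\<^sup>2\<bar> \<le> 9" if "z \<in> space (obs_space X)" for z
    using power_mono[OF l3[OF that], of 2] by simp
  have l2_int: "integrable ?P (\<lambda>z. (l z)\<^sup>2)"
    by (rule integral_obs_distr(1)[OF X g.bounded_density_tilt _ l9]) measurable
  \<comment> \<open>Each label contributes 2V times ((f - g)/2)^2 with probability weight 1/2;
    together this gives the factor V/2.\<close>
  have l2_val: "(\<integral>z. (l z)\<^sup>2 \<partial>?P) \<le> 1 + ?V / 2 * Q"
  proof -
    have d_int: "integrable ?M (\<lambda>x. (f x - g x)\<^sup>2)"
    proof (rule f.integrable_leb_on_bounded)
      show "(\<lambda>x. (f x - g x)\<^sup>2) \<in> borel_measurable ?M" by measurable
      show "\<bar>(f x - g x)\<^sup>2\<bar> \<le> (2 / ?V)\<^sup>2" if "x \<in> X" for x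
        using f.f_bound[OF that] g.f_bound[OF that] by (simp add: abs_le_square_iff[symmetric])
    qed
    have "(\<integral>z. (l z)\<^sup>2 \<partial>?P) = (\<integral>x. 1 / 2 * (g.p x * (l (x, 1))\<^sup>2 + g.q x * (l (x, -1))\<^sup>2) \<partial>?M)"
      by (rule integral_obs_distr(2)[OF X g.bounded_density_tilt _ l9]) measurable
    also have "\<dots> \<le> (\<integral>x. 1 / ?V + ?V / 2 * (f x - g x)\<^sup>2 \<partial>?M)"
    proof (rule integral_mono')
      show "integrable ?M (\<lambda>x. 1 / ?V + ?V / 2 * (f x - g x)\<^sup>2)" using d_int by simp
      fix x assume "x \<in> space ?M"
      then have x: "x \<in> X" by (simp add: space_leb_on)
      have "g.p x * (l (x, 1))\<^sup>2 \<le> g.p x + 2 * (f.p x - g.p x) + 2 * ?V * (f.p x - g.p x)\<^sup>2"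
        "g.q x * (l (x, -1))\<^sup>2 \<le> g.q x + 2 * (f.q x - g.q x) + 2 * ?V * (f.q x - g.q x)\<^sup>2"
        using ratio_sq_le[of ?V "g.p x" "f.p x"] ratio_sq_le[of ?V "g.q x" "f.q x"] g.tilt_bounds[OF x] f.V_pos
        by (simp_all add: l_def)
      moreover have "f.p x - g.p x = (f x - g x) / 2" "f.q x - g.q x = - ((f x - g x) / 2)"
        "g.p x + g.q x = 2 / ?V"
        by (simp_all add: tilt_def field_simps)
      ultimately show "1 / 2 * (g.p x * (l (x, 1))\<^sup>2 + g.q x * (l (x, -1))\<^sup>2) \<le> 1 / ?V + ?V / 2 * (f x - g x)\<^sup>2"
        by (simp add: power_divide)
      show "0 \<le> 1 / ?V + ?V / 2 * (f x - g x)\<^sup>2" using f.V_pos by simp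
    qed
    also have "\<dots> = (\<integral>x. 1 / ?V \<partial>?M) + ?V / 2 * (\<integral>x. (f x - g x)\<^sup>2 \<partial>?M)"
      using d_int by (subst Bochner_Integration.integral_add) simp_all
    also have "(\<integral>x. 1 / ?V \<partial>?M) = 1" unfolding f.integral_const_leb_on using f.V_pos by simp
    also have "1 + ?V / 2 * (\<integral>x. (f x - g x)\<^sup>2 \<partial>?M) \<le> 1 + ?V / 2 * Q"
      using Q(1) f.V_pos by (intro add_left_mono mult_left_mono) auto
    finally show ?thesis .
  qed
  define a where "a = measure ?M A"
  \<comment> \<open>The classifier read as a randomised test: \<open>Z D\<close> is the fraction of
    \<open>A\<close> given label -1, an error under \<open>f\<close>, and \<open>1 - Z D\<close> is
    the fraction given label 1, an error under \<open>g\<close>. An error at a point of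
    \<open>A\<close> costs at least \<eta>/2 in either case.\<close>
  define Z where "Z D = (\<integral>x. indicator A x * (if 0 \<le> h D x then 0 else 1) \<partial>?M) / a" for D
  have a: "0 < a" using A(2) by (simp add: a_def)
  have Z_m: "Z \<in> borel_measurable ?S" unfolding Z_def by measurable
  have ind: "(\<integral>x. indicator A x \<partial>?M) = a"
    using A(1) by (simp add: a_def Int_absorb2 sets.sets_into_space)
  have ints: "integrable ?M (\<lambda>x. indicator A x * (if 0 \<le> h D x then u else v))"
    if D: "D \<in> space ?S" for D and u v :: real
  proof (rule f.integrable_leb_on_bounded)
    note [measurable] = estimator_measurable(2)[OF X(1) h D]
    show "(\<lambda>x. indicator A x * (if 0 \<le> h D x then u else v)) \<in> borel_measurable ?M" by measurable
    show "\<bar>indicator A x * (if 0 \<le> h D x then u else v)\<bar> \<le> \<bar>u\<bar> + \<bar>v\<bar>" for x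
      by (simp add: indicator_def)
  qed
  have oneZ: "1 - Z D = (\<integral>x. indicator A x * (if 0 \<le> h D x then 1 else 0) \<partial>?M) / a" if D: "D \<in> space ?S" for D
  proof -
    have "(\<integral>x. indicator A x * (if 0 \<le> h D x then 0 else 1 :: real) \<partial>?M) + (\<integral>x. indicator A x * (if 0 \<le> h D x then 1 else 0) \<partial>?M)
        = (\<integral>x. indicator A x * (if 0 \<le> h D x then 0 else 1) + indicator A x * (if 0 \<le> h D x then 1 else 0) \<partial>?M)"
      by (intro Bochner_Integration.integral_add[symmetric] ints D)
    also have "\<dots> = (\<integral>x. indicator A x \<partial>?M)"
      by (intro Bochner_Integration.integral_cong) auto
    finally show ?thesis unfolding Z_def ind using a by (simp add: field_simps)
  qed
  have Z0: "0 \<le> Z D" for D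
    unfolding Z_def using a by (intro divide_nonneg_pos Bochner_Integration.integral_nonneg) auto
  have Z1: "Z D \<le> 1" if "D \<in> space ?S" for D
  proof -
    have "0 \<le> 1 - Z D"
      unfolding oneZ[OF that] using a by (intro divide_nonneg_pos Bochner_Integration.integral_nonneg) auto
    then show ?thesis by simp
  qed
  have sub: "A \<subseteq> X" using sets.sets_into_space[OF A(1)] by (simp add: space_leb_on)
  have f_ge: "\<eta> * a / 2 * Z D \<le> excess_risk X f.p f.q (h D) (\<lambda>x. f.p x - f.q x)" if D: "D \<in> space ?S" for D
  proof -
    have "\<eta> * a / 2 * Z D = (\<integral>x. \<eta> / 2 * (indicator A x * (if 0 \<le> h D x then 0 else 1)) \<partial>?M)"
      using a by (simp add: Z_def)
    also have "\<dots> \<le> excess_risk X f.p f.q (h D) (\<lambda>x. f.p x - f.q x)"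
    proof (rule f.integral_le_excess_risk)
      show "h D \<in> borel_measurable ?M" by (rule estimator_measurable(2)[OF X(1) h D])
      show "(\<lambda>x. \<eta> / 2 * (indicator A x * (if 0 \<le> h D x then 0 else 1))) \<in> borel_measurable ?M"
        using ints[OF D] by (intro borel_measurable_times borel_measurable_integrable) auto
      show "0 \<le> \<eta> / 2 * (indicator A x * (if 0 \<le> h D x then 0 else 1))" for x
        using sep(1) by simp
      show "\<eta> / 2 * (indicator A x * (if 0 \<le> h D x then 0 else 1)) \<le> f.loss (h D) x" for x
        using sep(1) sep(2)[of x] by (auto simp: f.loss_def indicator_def)
    qed
    finally show ?thesis .
  qed
  have g_ge: "\<eta> * a / 2 * (1 - Z D) \<le> excess_risk X g.p g.q (h D) (\<lambda>x. g.p x - g.q x)" if D: "D \<in> space ?S" for D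
  proof -
    have "\<eta> * a / 2 * (1 - Z D) = (\<integral>x. \<eta> / 2 * (indicator A x * (if 0 \<le> h D x then 1 else 0)) \<partial>?M)"
      using a by (simp add: oneZ[OF D])
    also have "\<dots> \<le> excess_risk X g.p g.q (h D) (\<lambda>x. g.p x - g.q x)"
    proof (rule g.integral_le_excess_risk)
      show "h D \<in> borel_measurable ?M" by (rule estimator_measurable(2)[OF X(1) h D])
      show "(\<lambda>x. \<eta> / 2 * (indicator A x * (if 0 \<le> h D x then 1 else 0))) \<in> borel_measurable ?M"
        using ints[OF D] by (intro borel_measurable_times borel_measurable_integrable) auto
      show "0 \<le> \<eta> / 2 * (indicator A x * (if 0 \<le> h D x then 1 else 0))" for x
        using sep(1) by simp
      show "\<eta> / 2 * (indicator A x * (if 0 \<le> h D x then 1 else 0)) \<le> g.loss (h D) x" for x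
        using sep(1) sep(2)[of x] by (auto simp: g.loss_def indicator_def)
    qed
    finally show ?thesis .
  qed
  have S_eq: "sets (Pi\<^sub>M {..<n} (\<lambda>_. ?P)) = sets ?S"
    using sets_sample_distr unfolding sample_distr_def .
  have test: "1 / 2 \<le> (\<integral>D. Z D \<partial>sample_distr X f.p f.q n) + (\<integral>D. 1 - Z D \<partial>sample_distr X g.p g.q n)"
    unfolding sample_distr_def l(2)
  proof (rule two_point_test[OF prob_space_obs_distr[OF X g.bounded_density_tilt] _ l_int l_val l2_int l2_val Q(2)])
    show "0 \<le> l x" for x by (simp add: l_def case_prod_unfold)
    show "Z \<in> borel_measurable (Pi\<^sub>M {..<n} (\<lambda>_. ?P))"
      using Z_m by (simp add: measurable_cong_sets[OF S_eq refl])
    show "0 \<le> Z x \<and> Z x \<le> 1" if "x \<in> space (Pi\<^sub>M {..<n} (\<lambda>_. ?P))" for x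
      using that Z0 Z1 sets_eq_imp_space_eq[OF S_eq] by simp
  qed
  have "\<eta> * a / 4 = \<eta> * a / 2 * (1 / 2)" by simp
  also have "\<dots> \<le> \<eta> * a / 2 * ((\<integral>D. Z D \<partial>sample_distr X f.p f.q n) + (\<integral>D. 1 - Z D \<partial>sample_distr X g.p g.q n))"
    using test sep(1) a by (intro mult_left_mono) auto
  also have "\<dots> = (\<integral>D. \<eta> * a / 2 * Z D \<partial>sample_distr X f.p f.q n) + (\<integral>D. \<eta> * a / 2 * (1 - Z D) \<partial>sample_distr X g.p g.q n)"
    by (simp add: distrib_left)
  also have "\<dots> \<le> (\<integral>D. excess_risk X f.p f.q (h D) (\<lambda>x. f.p x - f.q x) \<partial>sample_distr X f.p f.q n)
      + (\<integral>D. excess_risk X g.p g.q (h D) (\<lambda>x. g.p x - g.q x) \<partial>sample_distr X g.p g.q n)"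
  proof (rule add_mono)
    show "(\<integral>D. \<eta> * a / 2 * Z D \<partial>sample_distr X f.p f.q n)
        \<le> (\<integral>D. excess_risk X f.p f.q (h D) (\<lambda>x. f.p x - f.q x) \<partial>sample_distr X f.p f.q n)"
      using Z_m Z0 f_ge sep(1) a by (intro f.expected_excess_risk_ge[OF h]) auto
    show "(\<integral>D. \<eta> * a / 2 * (1 - Z D) \<partial>sample_distr X g.p g.q n)
        \<le> (\<integral>D. excess_risk X g.p g.q (h D) (\<lambda>x. g.p x - g.q x) \<partial>sample_distr X g.p g.q n)"
      using Z_m Z1 g_ge sep(1) a by (intro g.expected_excess_risk_ge[OF h]) auto
  qed
  finally show ?thesis by (simp add: a_def)
qed

text \<open>The hypotheses are fixed before the estimator; only the choice of the worse one depends
  on it. As the bound holds for each estimator separately, the constant is the same for every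
  \<open>G\<close>, and an empty set of estimators is covered too.\<close>

lemma minimax_lower_bound:
  fixes X :: "(real ^ 'd::finite) set"
  assumes X: "X \<in> sets borel" "bounded X" "0 < emeasure lborel X"
  obtains B F c r where "0 < r"
    "\<forall>n L N S B' F' c' T G. 0 < n \<and> 1 \<le> L \<and> 4 \<le> N \<and> 4 * CARD('d) + 9 \<le> S \<and> B \<le> B' \<and> F \<le> F' \<and> c \<le> c' \<longrightarrow>
      ereal (r * (1 / real n) powr (2 / 3)) \<le> minimax_excess_risk X n G (teacher_class X L N S B' F' c' T)"
proof -
  obtain B F c \<kappa> C \<delta>0 where pos: "0 < c" "0 < \<kappa>" "0 < C" "0 < \<delta>0"
    and pair: "\<forall>\<delta>. 0 < \<delta> \<and> \<delta> \<le> \<delta>0 \<longrightarrow> (\<exists>f g A. contrast X c B F f \<and> contrast X c B F g \<and>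
        (\<integral>x. (f x - g x)\<^sup>2 \<partial>leb_on X) \<le> C * \<delta> ^ 3 \<and>
        A \<in> sets (leb_on X) \<and> \<kappa> * \<delta> \<le> measure (leb_on X) A \<and>
        (\<forall>x\<in>A. \<kappa> * \<delta> \<le> f x \<and> g x \<le> - (\<kappa> * \<delta>)))"
    by (rule contrast_pair[OF X])
  define V where "V = measure lborel X"
  have V: "0 < V"
    using X emeasure_bounded_finite[OF X(2)] by (simp add: V_def measure_def enn2real_positive_iff)
  \<comment> \<open>The cap 1 gives \<rho>^3 at most \<rho>; the last term then brings the n-fold
    chi-square bound below the 1/5 of \<open>two_point_test\<close>.\<close>
  define \<rho> where "\<rho> = min (min \<delta>0 1) (2 / (5 * V * C))"
  have \<rho>: "0 < \<rho>" "\<rho> \<le> \<delta>0" "\<rho> \<le> 1" "\<rho> \<le> 2 / (5 * V * C)" using pos V by (auto simp: \<rho>_def)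
  have \<rho>3: "V / 2 * (C * \<rho> ^ 3) \<le> 1 / 5"
  proof -
    have "\<rho> ^ 3 \<le> \<rho>" using \<rho> power_decreasing[of 1 3 \<rho>] by simp
    also note \<rho>(4)
    finally have "V / 2 * (C * \<rho> ^ 3) \<le> V / 2 * (C * (2 / (5 * V * C)))"
      using V pos by (intro mult_left_mono) auto
    also have "\<dots> = 1 / 5" using V pos by simp
    finally show ?thesis .
  qed
  show ?thesis
  \<comment> \<open>The two risks add up to at least (\<kappa>\<delta>)^2/4, so one of them is at
    least half of that; \<delta>^2 is \<rho>^2 n^(-2/3).\<close>
  proof (rule that[of "(\<kappa> * \<rho>)\<^sup>2 / 8" B F c], use pos \<rho> in simp, intro allI impI, elim conjE)
    fix n L N S :: nat and B' F' c' T :: real and G :: "(real ^ 'd \<Rightarrow> real) set"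
    assume n: "0 < n" and LNS: "1 \<le> L" "4 \<le> N" "4 * CARD('d) + 9 \<le> S" "B \<le> B'" "F \<le> F'" "c \<le> c'"
    define s where "s = (1 / real n) powr (1 / 3)"
    have s: "0 < s" "s \<le> 1" using n by (auto simp: s_def intro!: powr_le1)
    have s3: "s ^ 3 = 1 / real n" and s2: "s\<^sup>2 = (1 / real n) powr (2 / 3)"
      using n by (simp_all add: s_def powr_power)
    define \<delta> where "\<delta> = \<rho> * s"
    have "\<delta> \<le> \<rho>" unfolding \<delta>_def using \<rho> s by (intro mult_left_le) auto
    moreover have "0 < \<delta>" using \<rho> s by (simp add: \<delta>_def)
    ultimately have \<delta>: "0 < \<delta>" "\<delta> \<le> \<delta>0" using \<rho>(2) by linarith+
    obtain f g A where fg: "contrast X c B F f" "contrast X c B F g"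
      and sq: "(\<integral>x. (f x - g x)\<^sup>2 \<partial>leb_on X) \<le> C * \<delta> ^ 3"
      and A: "A \<in> sets (leb_on X)" "\<kappa> * \<delta> \<le> measure (leb_on X) A"
      and sep: "\<forall>x\<in>A. \<kappa> * \<delta> \<le> f x \<and> g x \<le> - (\<kappa> * \<delta>)"
      using pair[rule_format, of \<delta>] \<delta> by blast
    have \<kappa>\<delta>: "0 < \<kappa> * \<delta>" using pos \<delta> by simp
    have eq: "real n * (V / 2 * (C * \<delta> ^ 3)) = V / 2 * (C * \<rho> ^ 3)"
      using n by (simp add: \<delta>_def power_mult_distrib s3)
    have small: "real n * (measure lborel X / 2 * (C * \<delta> ^ 3)) \<le> 1 / 5"
      unfolding V_def[symmetric] eq by (rule \<rho>3)
    let ?b = "(\<kappa> * \<rho>)\<^sup>2 / 8 * (1 / real n) powr (2 / 3)"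
    let ?T = "teacher_class X L N S B' F' c' T"
    have "ereal ?b \<le> (SUP (p, q)\<in>?T.
        ereal (\<integral>D. excess_risk X p q (h D) (\<lambda>x. p x - q x) \<partial>sample_distr X p q n))" if h: "h \<in> estimators X n G" for h
    proof -
      let ?E = "\<lambda>u. \<integral>D. excess_risk X (tilt X u) (tilt X (\<lambda>x. - u x)) (h D) (\<lambda>x. tilt X u x - tilt X (\<lambda>x. - u x) x)
        \<partial>sample_distr X (tilt X u) (tilt X (\<lambda>x. - u x)) n"
      have "\<kappa> * \<delta> * measure (leb_on X) A / 4 \<le> ?E f + ?E g"
        using A \<kappa>\<delta> sep by (intro two_point_risk[OF fg sq small A(1) _ \<kappa>\<delta> _ h]) auto
      moreover have "\<kappa> * \<delta> * (\<kappa> * \<delta>) \<le> \<kappa> * \<delta> * measure (leb_on X) A"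
        using A(2) \<kappa>\<delta> by (intro mult_left_mono) auto
      moreover have "2 * ?b = \<kappa> * \<delta> * (\<kappa> * \<delta>) / 4"
        by (simp add: s2[symmetric] \<delta>_def power2_eq_square)
      ultimately have "2 * ?b \<le> ?E f + ?E g" by linarith
      then have "?b \<le> ?E f \<or> ?b \<le> ?E g" by linarith
      then obtain u where u: "contrast X c B F u" "?b \<le> ?E u" using fg by blast
      show ?thesis
        using contrast.tilt_in_teacher_class[OF u(1) LNS, of T] u(2)
        by (intro SUP_upper2[of "(tilt X u, tilt X (\<lambda>x. - u x))"]) auto
    qed
    then show "ereal ?b \<le> minimax_excess_risk X n G ?T"
      unfolding minimax_excess_risk_def by (intro INF_greatest)
  qed
qed

text \<open>The thresholds are the parameters of the two hypotheses and depend on \<open>X\<close>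
  alone; beyond them every class in the sequence contains both.\<close>

theorem theorem3p3:
  shows "\<exists>k::real. \<forall>X :: (real ^ 'd::finite) set.
    X \<in> sets borel \<and> bounded X \<and> 0 < emeasure lborel X \<longrightarrow>
    (\<exists>(N0::nat) (S0::nat) (B0::real) (F0::real) (c0::real).
      \<forall>(m::real) (L :: nat \<Rightarrow> nat) (N :: nat \<Rightarrow> nat) (S :: nat \<Rightarrow> nat)
        (B :: nat \<Rightarrow> real) (F :: nat \<Rightarrow> real) (c :: nat \<Rightarrow> real) (T :: nat \<Rightarrow> real)
        (G :: nat \<Rightarrow> (real ^ 'd \<Rightarrow> real) set).
        1 \<le> m \<longrightarrow>
        (\<lambda>n. real (L n)) \<in> O(\<lambda>_. 1) \<longrightarrow>
        (\<lambda>n. real (N n)) \<in> O(\<lambda>n. ln (real n) powr m) \<longrightarrow>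
        c \<in> O(\<lambda>n. ln (real n) powr (m * real (CARD('d))^2 * real (L n))) \<longrightarrow>
        (\<forall>n. 0 < T n) \<longrightarrow>
        (\<lambda>n. 1 / T n) \<in> O(\<lambda>n. ln (real n) powr (m * real (CARD('d))^2 * real (L n))) \<longrightarrow>
        (\<forall>\<^sub>F n in sequentially.
           1 \<le> L n \<and> N0 \<le> N n \<and> S0 \<le> S n \<and> B0 \<le> B n \<and> F0 \<le> F n \<and> c0 \<le> c n) \<longrightarrow>
        tilde_Omega k
          (\<lambda>n. minimax_excess_risk X n (G n)
                 (teacher_class X (L n) (N n) (S n) (B n) (F n) (c n) (T n)))
          (\<lambda>n. (1 / real n) powr (2 / 3)))"
\<comment> \<open>No logarithm is lost, because the sizes and constants of the two hypotheses do not
  grow with n.\<close>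
proof (rule exI[of _ 0], intro allI impI, elim conjE)
  fix X :: "(real ^ 'd) set"
  assume X: "X \<in> sets borel" "bounded X" "0 < emeasure lborel X"
  obtain B0 F0 c0 r where r: "0 < r"
    and lower: "\<forall>n L N S B F c T G. 0 < n \<and> 1 \<le> L \<and> 4 \<le> N \<and> 4 * CARD('d) + 9 \<le> S \<and> B0 \<le> B \<and> F0 \<le> F \<and> c0 \<le> c \<longrightarrow>
      ereal (r * (1 / real n) powr (2 / 3)) \<le> minimax_excess_risk X n G (teacher_class X L N S B F c T)"
    by (rule minimax_lower_bound[OF X])
  have "tilde_Omega 0
      (\<lambda>n. minimax_excess_risk X n (G n) (teacher_class X (L n) (N n) (S n) (B n) (F n) (c n) (T n)))
      (\<lambda>n. (1 / real n) powr (2 / 3))"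
    if "\<forall>\<^sub>F n in sequentially. 1 \<le> L n \<and> 4 \<le> N n \<and> 4 * CARD('d) + 9 \<le> S n \<and> B0 \<le> B n \<and> F0 \<le> F n \<and> c0 \<le> c n"
    for L N S :: "nat \<Rightarrow> nat" and B F c T :: "nat \<Rightarrow> real" and G :: "nat \<Rightarrow> (real ^ 'd \<Rightarrow> real) set"
    unfolding tilde_Omega_def
  proof (intro exI[of _ r] conjI r)
    show "\<forall>\<^sub>F n in sequentially. ereal (r * (1 / real n) powr (2 / 3) / ln (real n) powr 0)
      \<le> minimax_excess_risk X n (G n) (teacher_class X (L n) (N n) (S n) (B n) (F n) (c n) (T n))"
      \<comment> \<open>At n = 1 the logarithm vanishes and \<open>0 powr 0\<close> is 0, not 1;
        from 2 on the logarithmic factor is 1.\<close>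
      using that eventually_ge_at_top[of 2]
    proof eventually_elim
      case (elim n)
      then have "ln (real n) powr 0 = 1" by simp
      then show ?case using lower elim by simp
    qed
  qed
  then show "\<exists>(N0::nat) (S0::nat) (B0::real) (F0::real) (c0::real).
      \<forall>(m::real) (L :: nat \<Rightarrow> nat) (N :: nat \<Rightarrow> nat) (S :: nat \<Rightarrow> nat)
        (B :: nat \<Rightarrow> real) (F :: nat \<Rightarrow> real) (c :: nat \<Rightarrow> real) (T :: nat \<Rightarrow> real)
        (G :: nat \<Rightarrow> (real ^ 'd \<Rightarrow> real) set).
        1 \<le> m \<longrightarrow>
        (\<lambda>n. real (L n)) \<in> O(\<lambda>_. 1) \<longrightarrow>
        (\<lambda>n. real (N n)) \<in> O(\<lambda>n. ln (real n) powr m) \<longrightarrow>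
        c \<in> O(\<lambda>n. ln (real n) powr (m * real (CARD('d))^2 * real (L n))) \<longrightarrow>
        (\<forall>n. 0 < T n) \<longrightarrow>
        (\<lambda>n. 1 / T n) \<in> O(\<lambda>n. ln (real n) powr (m * real (CARD('d))^2 * real (L n))) \<longrightarrow>
        (\<forall>\<^sub>F n in sequentially.
           1 \<le> L n \<and> N0 \<le> N n \<and> S0 \<le> S n \<and> B0 \<le> B n \<and> F0 \<le> F n \<and> c0 \<le> c n) \<longrightarrow>
        tilde_Omega 0
          (\<lambda>n. minimax_excess_risk X n (G n)
                 (teacher_class X (L n) (N n) (S n) (B n) (F n) (c n) (T n)))
          (\<lambda>n. (1 / real n) powr (2 / 3))"
    by (intro exI[of _ 4] exI[of _ "4 * CARD('d) + 9"] exI[of _ B0] exI[of _ F0] exI[of _ c0]) blast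
qed

end
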